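(* Let $u$ be the solution of the elastodynamic equation $\rho\ddot u=\mathbb{C}u_{xx}+b$ and, for each $\epsilon>0$, let $u^\epsilon$ be the solution of the nonlinear peridynamic equation $\rho\ddot u^\epsilon(t,x)=-\nabla PD^\epsilon(u^\epsilon(t))(x)+b(t,x)$, for $(x,t)\in D\times J$, with the initial and boundary conditions described in the context. Let $e^\epsilon:=u^\epsilon-u$. Suppose $u^\epsilon(t)\in C^4(D)$ for all $\epsilon>0$ and $t\in[0,T]$, and suppose there exists $C_1>0$, independent of $\epsilon$, such that $$\sup_{\epsilon>0}\Big\{\sup_{(x,t)\in D\times J}|u^\epsilon_{xxxx}(t,x)|\Big\}<C_1<\infty .$$ Then for $\epsilon<\delta$ there is a constant $C_2>0$, independent of $\delta$ and $\epsilon$, such that $$\sup_{t\in[0,T]}\Big\{\int_D\rho|\dot e^\epsilon(t,x)|^2\,dx+\int_D\mathbb{C}|e^\epsilon_x(t,x)|^2\,dx\Big\}\le C_2\epsilon^2,$$ so that $u^\epsilon\to u$ in the $H^1(D)$ norm at the rate $\epsilon$ uniformly in time $t\in[0,T]$ (that is, $\sup_{t\in[0,T]}\|u^\epsilon(t)-u(t)\|_1\le C\epsilon$ with $C$ independent of $\epsilon$).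
   Context: $D=[a,b]\subset\mathbb{R}$ is a bounded interval, $J=[0,T]$ is the time interval (the same letter $J$ is also used for the influence function below), and $\epsilon>0$ is the horizon. The nonlocal boundary is $\partial D^\epsilon=(a-\epsilon,a+\epsilon)\cup(b-\epsilon,b+\epsilon)$. The strain is $S(y,x;u)=\frac{u(y)-u(x)}{|y-x|}$. The function $f:[0,\infty)\to\mathbb{R}$ is positive (for $r>0$), smooth and concave with $\lim_{r\to0^+}f(r)/r=f'(0)$ and $\lim_{r\to\infty}f(r)=f_\infty<\infty$, and $f'',f''',f''''$ are bounded on $(0,\infty)$. The influence function $J(|\xi|)$ is (measurable and) zero for $\xi$ outside $[-1,1]$ and satisfies $0\le J(|\xi|)\le M$ on $[-1,1]$. The nonlinear peridynamic force is $$-\nabla PD^\epsilon(u)(x)=\frac{2}{\epsilon^2}\int_{x-\epsilon}^{x+\epsilon}J(|y-x|/\epsilon)\,f'\big(|y-x|S(y,x;u)^2\big)\,S(y,x;u)\,dy .$$ The Young's modulus is $\mathbb{C}=\int_{-1}^1J(|z|)f'(0)|z|\,dz$, and it is positive. The mass density $\rho>0$ is constant and $b(t,x)$ is a prescribed body force, the same in both equations. Boundary conditions: $u^\epsilon(t,x)=0$ and $\dot u^\epsilon(t,x)=0$ for all $t\in[0,T]$, $x\in\partial D^\epsilon$; $u=0$ (and $\dot u=0$) at the endpoints of $D$, and $u$ is extended by zero outside $D$. Initial conditions (the same for $u^\epsilon$ and $u$): $u^\epsilon(0,x)=g(x)$, $\dot u^\epsilon(0,x)=h(x)$ for $x\in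 D$, where $g=h=0$ outside some fixed subset $D'$ of $D$; $\delta$ denotes the width of the layer $D\setminus D'$. $C^4(D)$ is the space of functions with four continuous derivatives on $D$, and $\|v\|_1=\sqrt{\int_D|v|^2dx+\int_D|v_x|^2dx}$. *)

theory Defs
  imports "HOL-Analysis.Analysis"
begin

(* Derivative relative to a set: one-sided at the end points of a closed interval. *)
definition deriv_on :: "real set \<Rightarrow> (real \<Rightarrow> real) \<Rightarrow> real \<Rightarrow> real" where
  "deriv_on S f x = vector_derivative f (at x within S)"

abbreviation nderiv_on :: "nat \<Rightarrow> real set \<Rightarrow> (real \<Rightarrow> real) \<Rightarrow> real \<Rightarrow> real" where
  "nderiv_on k S f \<equiv> (deriv_on S ^^ k) f"

definition Ck_on :: "nat \<Rightarrow> real set \<Rightarrow> (real \<Rightarrow> real) \<Rightarrow> bool" where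
  "Ck_on k S f \<longleftrightarrow>
     (\<forall>j<k. \<forall>x\<in>S. nderiv_on j S f differentiable (at x within S)) \<and>
     (\<forall>j\<le>k. continuous_on S (nderiv_on j S f))"

definition smooth_on :: "real set \<Rightarrow> (real \<Rightarrow> real) \<Rightarrow> bool" where
  "smooth_on S f \<longleftrightarrow> (\<forall>k. Ck_on k S f)"

definition admissible_potential :: "(real \<Rightarrow> real) \<Rightarrow> bool" where
  "admissible_potential f \<longleftrightarrow>
     (\<forall>r>0. f r > 0) \<and> smooth_on {0..} f \<and> concave_on {0..} f \<and>
     ((\<lambda>r. f r / r) \<longlongrightarrow> deriv_on {0..} f 0) (at_right 0) \<and>
     (\<exists>f_inf. (f \<longlongrightarrow> f_inf) at_top) \<and>
     (\<forall>k\<in>{2, 3, 4}. bounded (nderiv_on k {0..} f ` {0<..}))"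

definition admissible_influence :: "real \<Rightarrow> (real \<Rightarrow> real) \<Rightarrow> bool" where
  "admissible_influence M J \<longleftrightarrow>
     (\<lambda>\<xi>. J \<bar>\<xi>\<bar>) \<in> borel_measurable lebesgue \<and>
     (\<forall>\<xi>. \<xi> \<notin> {-1..1} \<longrightarrow> J \<bar>\<xi>\<bar> = 0) \<and>
     (\<forall>\<xi>\<in>{-1..1}. 0 \<le> J \<bar>\<xi>\<bar> \<and> J \<bar>\<xi>\<bar> \<le> M)"

definition strain :: "(real \<Rightarrow> real) \<Rightarrow> real \<Rightarrow> real \<Rightarrow> real" where
  "strain u y x = (u y - u x) / \<bar>y - x\<bar>"

(* The peridynamic force, i.e. minus the gradient of the peridynamic energy. *)
definition pd_force ::
    "(real \<Rightarrow> real) \<Rightarrow> (real \<Rightarrow> real) \<Rightarrow> real \<Rightarrow> (real \<Rightarrow> real) \<Rightarrow> real \<Rightarrow> real" where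
  "pd_force f J \<epsilon> u x =
     2 / \<epsilon>\<^sup>2 * (LINT y:{x - \<epsilon>..x + \<epsilon>}|lebesgue.
        J (\<bar>y - x\<bar> / \<epsilon>) * deriv_on {0..} f (\<bar>y - x\<bar> * (strain u y x)\<^sup>2) * strain u y x)"

definition youngs_modulus :: "(real \<Rightarrow> real) \<Rightarrow> (real \<Rightarrow> real) \<Rightarrow> real" where
  "youngs_modulus f J = (LINT z:{-1..1}|lebesgue. J \<bar>z\<bar> * deriv_on {0..} f 0 * \<bar>z\<bar>)"

(* Functions of time and space are curried, time first. *)
definition time_deriv :: "real \<Rightarrow> nat \<Rightarrow> (real \<Rightarrow> real \<Rightarrow> real) \<Rightarrow> real \<Rightarrow> real \<Rightarrow> real" where
  "time_deriv T k u t x = nderiv_on k {0..T} (\<lambda>s. u s x) t"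

(* The space C^2([0,T]; C[a,b]), written pointwise. *)
definition C2_in_time :: "real \<Rightarrow> real \<Rightarrow> real \<Rightarrow> (real \<Rightarrow> real \<Rightarrow> real) \<Rightarrow> bool" where
  "C2_in_time a b T u \<longleftrightarrow>
     (\<forall>x\<in>{a..b}. Ck_on 2 {0..T} (\<lambda>s. u s x)) \<and>
     (\<forall>k\<le>2. continuous_on ({0..T} \<times> {a..b}) (\<lambda>(t, x). time_deriv T k u t x))"

(* The space C([0,T]; C^2[a,b]), written pointwise. *)
definition C2_in_space :: "real \<Rightarrow> real \<Rightarrow> real \<Rightarrow> (real \<Rightarrow> real \<Rightarrow> real) \<Rightarrow> bool" where
  "C2_in_space a b T u \<longleftrightarrow>
     (\<forall>t\<in>{0..T}. Ck_on 2 {a..b} (u t)) \<and>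
     (\<forall>k\<le>2. continuous_on ({0..T} \<times> {a..b}) (\<lambda>(t, x). nderiv_on k {a..b} (u t) x))"

definition initial_cond ::
    "real \<Rightarrow> real \<Rightarrow> real \<Rightarrow> (real \<Rightarrow> real) \<Rightarrow> (real \<Rightarrow> real) \<Rightarrow> (real \<Rightarrow> real \<Rightarrow> real) \<Rightarrow> bool" where
  "initial_cond a b T g h u \<longleftrightarrow> (\<forall>x\<in>{a..b}. u 0 x = g x \<and> time_deriv T 1 u 0 x = h x)"

definition elastodynamic_solution ::
    "real \<Rightarrow> real \<Rightarrow> real \<Rightarrow> real \<Rightarrow> real \<Rightarrow> (real \<Rightarrow> real \<Rightarrow> real) \<Rightarrow>
     (real \<Rightarrow> real) \<Rightarrow> (real \<Rightarrow> real) \<Rightarrow> (real \<Rightarrow> real \<Rightarrow> real) \<Rightarrow> bool" where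
  "elastodynamic_solution a b T \<rho> E bf g h u \<longleftrightarrow>
     C2_in_time a b T u \<and> C2_in_space a b T u \<and>
     (\<forall>t\<in>{0..T}. \<forall>x\<in>{a..b}.
        \<rho> * time_deriv T 2 u t x = E * nderiv_on 2 {a..b} (u t) x + bf t x) \<and>
     (\<forall>t\<in>{0..T}. \<forall>x\<in>{a, b}. u t x = 0 \<and> time_deriv T 1 u t x = 0) \<and>
     (\<forall>t\<in>{0..T}. \<forall>x. x \<notin> {a..b} \<longrightarrow> u t x = 0) \<and>
     initial_cond a b T g h u"

definition nonlocal_boundary :: "real \<Rightarrow> real \<Rightarrow> real \<Rightarrow> real set" where
  "nonlocal_boundary a b \<epsilon> = {a - \<epsilon><..<a + \<epsilon>} \<union> {b - \<epsilon><..<b + \<epsilon>}"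

(* Only the values of u t on [a - eps, b + eps] enter, so, up to two null points,
   u is determined as a function on the union of [a,b] and the nonlocal boundary. *)
definition peridynamic_solution ::
    "real \<Rightarrow> real \<Rightarrow> real \<Rightarrow> real \<Rightarrow> (real \<Rightarrow> real) \<Rightarrow> (real \<Rightarrow> real) \<Rightarrow> (real \<Rightarrow> real \<Rightarrow> real) \<Rightarrow>
     (real \<Rightarrow> real) \<Rightarrow> (real \<Rightarrow> real) \<Rightarrow> real \<Rightarrow> (real \<Rightarrow> real \<Rightarrow> real) \<Rightarrow> bool" where
  "peridynamic_solution a b T \<rho> f J bf g h \<epsilon> u \<longleftrightarrow>
     C2_in_time a b T u \<and>
     (\<forall>t\<in>{0..T}. \<forall>x\<in>{a..b}.
        \<rho> * time_deriv T 2 u t x = pd_force f J \<epsilon> (u t) x + bf t x) \<and>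
     (\<forall>t\<in>{0..T}. \<forall>x\<in>nonlocal_boundary a b \<epsilon>. u t x = 0 \<and> time_deriv T 1 u t x = 0) \<and>
     initial_cond a b T g h u"

(* For continuously differentiable v; the weak derivative is then the classical one. *)
definition H1_norm :: "real \<Rightarrow> real \<Rightarrow> (real \<Rightarrow> real) \<Rightarrow> real" where
  "H1_norm a b v =
     sqrt ((LINT x:{a..b}|lebesgue. \<bar>v x\<bar>\<^sup>2) + (LINT x:{a..b}|lebesgue. \<bar>deriv_on {a..b} v x\<bar>\<^sup>2))"

end

theory Submission
  imports Defs
begin

text \<open>
The error \<open>e\<close>, the peridynamic minus the elastodynamic displacement, solves the wave equation
\<open>\<rho> e_tt = E e_xx + r\<close> with zero initial data and zero values at the end points. The source
\<open>r\<close> is the consistency error: peridynamic force minus \<open>E\<close> times the second derivative, both taken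
of the peridynamic displacement. So the claim splits into consistency, \<open>\<bar>r\<bar> \<le> K \<epsilon>\<close>, and
stability, an energy estimate for the wave equation.

Consistency (\<open>pd_force_consistency\<close>). After the substitution \<open>y = x + \<epsilon> z\<close> the force is
\<open>2 / \<epsilon>\<close> times the integral of \<open>J \<bar>z\<bar>\<close> against \<open>f'(\<epsilon> \<bar>z\<bar> S\<^sup>2) S\<close>. Expanding the
strain \<open>S\<close> and \<open>f'\<close> to first order in \<open>\<epsilon> z\<close> leaves a remainder of order \<open>\<epsilon>\<^sup>2\<close>. Among
the retained terms those odd in \<open>z\<close> integrate to zero, also the one carrying \<open>f''(0)\<close>, and the even
one gives exactly the modulus times the second derivative. The constant involves bounds for the
first three space derivatives of the displacement. They come from the bound on the fourth one: the
displacement vanishes on the nonlocal boundary, hence so do all its derivatives there, and its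
extension by zero is as smooth as the displacement itself (\<open>zero_ext_nderiv_on\<close>), with lower
derivatives bounded by repeated integration from \<open>a\<close> (\<open>zero_ext_nderiv_on_bound\<close>).

Stability (\<open>energy_estimate\<close>). Formally the energy \<open>N\<close>, the integral of \<open>\<rho> e_t\<^sup>2 + E e_x\<^sup>2\<close>,
has derivative twice the integral of \<open>e_t r\<close>, and Young's inequality followed by Gronwall's finishes.
To avoid the mixed derivative \<open>e_tx\<close>, the gradient part is differentiated
through its increments: integration by parts in space turns them into integrals of \<open>e\<close> times
\<open>e_xx\<close> (\<open>gradient_energy_derivative\<close>). This uses joint continuity of \<open>e_xx\<close>, which for the
peridynamic displacement follows from its joint continuity and the uniform Lipschitz bound on its
second space derivative, since second differences then converge uniformly
(\<open>second_derivative_jointly_continuous\<close>). The bound in the Sobolev norm follows with a Poincare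
inequality.
\<close>

section \<open>Zero extension across the nonlocal boundary\<close>

lemma Ck_on_has_derivative:
  assumes "Ck_on k S f" and "j < k" and "x \<in> S"
  shows "(nderiv_on j S f has_real_derivative nderiv_on (Suc j) S f x) (at x within S)"
proof -
  have "nderiv_on j S f differentiable (at x within S)"
    using assms by (auto simp: Ck_on_def)
  then show ?thesis
    by (simp add: deriv_on_def vector_derivative_works has_real_derivative_iff_has_vector_derivative)
qed

lemma deriv_on_Icc_eqI:
  assumes "a < b" and "x \<in> {a..b}" and "(f has_real_derivative d) (at x within {a..b})"
  shows "deriv_on {a..b} f x = d"
  using assms vector_derivative_within_closed_interval
  by (simp add: deriv_on_def has_real_derivative_iff_has_vector_derivative)

text \<open>
A function vanishing near a point, relative to the interval, agrees locally with the zero function,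
so one-sided derivatives at the end points vanish too.
\<close>

lemma nderiv_on_eq_0:
  assumes ab: "a < b" and "open U" and zero: "\<And>x. x \<in> U \<inter> {a..b} \<Longrightarrow> f x = 0"
    and "x \<in> U \<inter> {a..b}"
  shows "nderiv_on j {a..b} f x = 0"
  using assms(4)
proof (induction j arbitrary: x)
  case 0
  then show ?case using zero by simp
next
  case (Suc j)
  obtain d where d: "0 < d" "ball x d \<subseteq> U"
    using Suc.prems \<open>open U\<close> by (meson IntD1 open_contains_ball)
  have "((\<lambda>_. 0) has_real_derivative 0) (at x within {a..b})" by simp
  then have "(nderiv_on j {a..b} f has_real_derivative 0) (at x within {a..b})"
    using d Suc by (elim has_field_derivative_transform_within[where d = d]) (auto simp: dist_commute subset_iff)
  then show ?case using Suc.prems ab by (simp add: deriv_on_Icc_eqI)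
qed

lemma bound_from_left_end:
  fixes w w' :: "real \<Rightarrow> real"
  assumes "\<And>x. x \<in> {a..b} \<Longrightarrow> (w has_real_derivative w' x) (at x within {a..b})"
    and "\<And>x. x \<in> {a..b} \<Longrightarrow> \<bar>w' x\<bar> \<le> B" and "w a = 0" and "x \<in> {a..b}"
  shows "\<bar>w x\<bar> \<le> B * (b - a)"
proof -
  have "norm (w x - w a) \<le> B * norm (x - a)"
    by (rule field_differentiable_bound[where S = "{a..b}" and f' = w'])
      (use assms in auto)
  also have "\<dots> \<le> B * (b - a)"
    using assms(2)[OF assms(4)] assms(4) by (intro mult_left_mono) auto
  finally show ?thesis using assms(3) by simp
qed

definition zero_ext :: "real \<Rightarrow> real \<Rightarrow> (real \<Rightarrow> real) \<Rightarrow> real \<Rightarrow> real" where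
  "zero_ext a b w x = (if x \<in> {a..b} then w x else 0)"

text \<open>
At the end points of the interval both sides vanish in a whole neighbourhood, because the nonlocal
boundary is open and contains them; this is what makes the extension differentiable there.
\<close>

lemma zero_ext_nderiv_on:
  assumes ab: "a < b" and eps: "0 < \<epsilon>" and Ck: "Ck_on k {a..b} w" and jk: "j < k"
    and zero: "\<And>x. x \<in> nonlocal_boundary a b \<epsilon> \<Longrightarrow> w x = 0"
  shows "(zero_ext a b (nderiv_on j {a..b} w) has_real_derivative
           zero_ext a b (nderiv_on (Suc j) {a..b} w) x) (at x)"
proof -
  have op: "open (nonlocal_boundary a b \<epsilon>)"
    by (auto simp: nonlocal_boundary_def)
  have zero': "zero_ext a b (nderiv_on i {a..b} w) y = 0" if "y \<in> nonlocal_boundary a b \<epsilon>" for i y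
    using nderiv_on_eq_0[OF ab op, of w y i] zero that by (auto simp: zero_ext_def)
  consider "x \<in> nonlocal_boundary a b \<epsilon>" | "x \<in> {a<..<b}" | "x \<in> - {a..b}"
    using eps by (force simp: nonlocal_boundary_def)
  then show ?thesis
  proof cases
    case 1
    have "((\<lambda>_. 0) has_real_derivative 0) (at x)" by simp
    then have "(zero_ext a b (nderiv_on j {a..b} w) has_real_derivative 0) (at x)"
      by (rule has_field_derivative_transform_within_open[OF _ op 1]) (simp only: zero')
    then show ?thesis using zero'[OF 1] by metis
  next
    case 2
    have "(nderiv_on j {a..b} w has_real_derivative nderiv_on (Suc j) {a..b} w x) (at x within {a..b})"
      using 2 by (intro Ck_on_has_derivative[OF Ck jk]) auto
    then have "(nderiv_on j {a..b} w has_real_derivative nderiv_on (Suc j) {a..b} w x) (at x)"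
      using 2 at_within_Icc_at[of a x b] by (metis greaterThanLessThan_iff)
    then have "(zero_ext a b (nderiv_on j {a..b} w) has_real_derivative
           nderiv_on (Suc j) {a..b} w x) (at x)"
      by (rule has_field_derivative_transform_within_open[OF _ _ 2]) (auto simp: zero_ext_def)
    moreover have "zero_ext a b (nderiv_on (Suc j) {a..b} w) x = nderiv_on (Suc j) {a..b} w x"
      unfolding zero_ext_def using 2 by (metis atLeastAtMost_iff greaterThanLessThan_iff less_imp_le)
    ultimately show ?thesis by metis
  next
    case 3
    have "((\<lambda>_. 0) has_real_derivative 0) (at x)" by simp
    then have "(zero_ext a b (nderiv_on j {a..b} w) has_real_derivative 0) (at x)"
      by (rule has_field_derivative_transform_within_open[OF _ _ 3]) (auto simp: zero_ext_def)
    moreover have "zero_ext a b (nderiv_on (Suc j) {a..b} w) x = 0"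
      unfolding zero_ext_def using 3 by (metis ComplD)
    ultimately show ?thesis by metis
  qed
qed

text \<open>
Every derivative vanishes at \<open>a\<close>, so passing from order \<open>j + 1\<close> down to order \<open>j\<close> costs a
factor \<open>b - a\<close>.
\<close>

lemma zero_ext_nderiv_on_bound:
  assumes ab: "a < b" and eps: "0 < \<epsilon>" and Ck: "Ck_on k {a..b} w"
    and zero: "\<And>x. x \<in> nonlocal_boundary a b \<epsilon> \<Longrightarrow> w x = 0"
    and top: "\<And>x. x \<in> {a..b} \<Longrightarrow> \<bar>nderiv_on k {a..b} w x\<bar> \<le> B"
    and "j \<le> k"
  shows "\<bar>zero_ext a b (nderiv_on j {a..b} w) x\<bar> \<le> B * (b - a) ^ (k - j)"
proof -
  have B: "0 \<le> B" using top[of a] ab by force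
  have op: "open (nonlocal_boundary a b \<epsilon>)"
    by (auto simp: nonlocal_boundary_def)
  have left: "nderiv_on i {a..b} w a = 0" for i
    by (rule nderiv_on_eq_0[OF ab op]) (use zero ab eps in \<open>auto simp: nonlocal_boundary_def\<close>)
  have "x \<in> {a..b} \<Longrightarrow> \<bar>nderiv_on j {a..b} w x\<bar> \<le> B * (b - a) ^ (k - j)" for x
    using \<open>j \<le> k\<close>
  proof (induction j arbitrary: x rule: inc_induct)
    case base
    then show ?case using top by simp
  next
    case (step n)
    have "\<bar>nderiv_on n {a..b} w x\<bar> \<le> B * (b - a) ^ (k - Suc n) * (b - a)"
      using step by (intro bound_from_left_end[OF Ck_on_has_derivative[OF Ck]] left) auto
    also have "\<dots> = B * (b - a) ^ (k - n)"
      using step.hyps by (metis Suc_diff_Suc mult.assoc mult.commute power_Suc)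
    finally show ?case .
  qed
  then show ?thesis using B ab by (auto simp: zero_ext_def)
qed

section \<open>Taylor bounds\<close>

text \<open>
The slope \<open>c\<close> is arbitrary: \<open>c = 0\<close> gives Lipschitz bounds and \<open>c = p' x\<close> the usual remainder
estimate. The set \<open>S\<close> allows one-sided derivatives, as for the potential at \<open>0\<close>.
\<close>

lemma first_order_Taylor_bound:
  fixes p p' :: "real \<Rightarrow> real"
  assumes S: "convex S" "x \<in> S" "y \<in> S"
    and p: "\<And>z. z \<in> S \<Longrightarrow> (p has_real_derivative p' z) (at z within S)"
    and p': "\<And>z. z \<in> S \<Longrightarrow> \<bar>z - x\<bar> \<le> \<bar>y - x\<bar> \<Longrightarrow> \<bar>p' z - c\<bar> \<le> K"
  shows "\<bar>p y - p x - c * (y - x)\<bar> \<le> K * \<bar>y - x\<bar>"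
proof -
  define I where "I = S \<inter> cball x \<bar>y - x\<bar>"
  have "norm ((p y - c * y) - (p x - c * x)) \<le> K * norm (y - x)"
  proof (rule field_differentiable_bound[where S = I and f = "\<lambda>z. p z - c * z" and f' = "\<lambda>z. p' z - c"])
    show "convex I" using S by (auto simp: I_def intro: convex_Int)
    fix z assume z: "z \<in> I"
    have "(p has_real_derivative p' z) (at z within I)"
      using z p by (auto simp: I_def intro: DERIV_subset)
    then show "((\<lambda>z. p z - c * z) has_real_derivative p' z - c) (at z within I)"
      by (auto intro!: derivative_eq_intros)
    show "norm (p' z - c) \<le> K"
      using z p' by (auto simp: I_def dist_real_def abs_minus_commute)
  qed (use S in \<open>auto simp: I_def dist_real_def\<close>)
  then show ?thesis by (simp add: algebra_simps)
qed

text \<open>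
A Lipschitz second derivative takes the place of a bounded third one; the constant is not optimal.
\<close>

lemma second_order_Taylor_bound:
  fixes p p' p'' :: "real \<Rightarrow> real"
  assumes p: "\<And>z. (p has_real_derivative p' z) (at z)"
    and p': "\<And>z. (p' has_real_derivative p'' z) (at z)"
    and lip: "\<And>z. \<bar>p'' z - p'' x\<bar> \<le> K * \<bar>z - x\<bar>"
  shows "\<bar>p (x + h) - p x - p' x * h - p'' x * h\<^sup>2 / 2\<bar> \<le> K * \<bar>h\<bar> ^ 3"
proof -
  have K: "0 \<le> K" using lip[of "x + 1"] by simp
  have 1: "\<bar>p' y - p' x - p'' x * (y - x)\<bar> \<le> K * h\<^sup>2" if "\<bar>y - x\<bar> \<le> \<bar>h\<bar>" for y
  proof -
    have "\<bar>p' y - p' x - p'' x * (y - x)\<bar> \<le> K * \<bar>h\<bar> * \<bar>y - x\<bar>"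
    proof (rule first_order_Taylor_bound[where S = UNIV])
      fix z assume "\<bar>z - x\<bar> \<le> \<bar>y - x\<bar>"
      then show "\<bar>p'' z - p'' x\<bar> \<le> K * \<bar>h\<bar>"
        using lip[of z] that K mult_left_mono[of "\<bar>z - x\<bar>" "\<bar>h\<bar>" K] by linarith
    qed (use p' in auto)
    also have "\<dots> \<le> K * \<bar>h\<bar> * \<bar>h\<bar>" using that K by (intro mult_left_mono) auto
    finally show ?thesis by (simp add: power2_eq_square)
  qed
  define q where "q y = p y - p' x * (y - x) - p'' x * (y - x)\<^sup>2 / 2" for y
  have "\<bar>q (x + h) - q x - 0 * (x + h - x)\<bar> \<le> K * h\<^sup>2 * \<bar>x + h - x\<bar>"
  proof (rule first_order_Taylor_bound[where S = UNIV])
    fix z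
    show "(q has_real_derivative p' z - p' x - p'' x * (z - x)) (at z)"
      unfolding q_def[abs_def] by (rule derivative_eq_intros p refl | simp)+
    assume "\<bar>z - x\<bar> \<le> \<bar>x + h - x\<bar>"
    then show "\<bar>p' z - p' x - p'' x * (z - x) - 0\<bar> \<le> K * h\<^sup>2" using 1[of z] by simp
  qed auto
  then show ?thesis
    by (simp add: q_def power2_eq_square power3_eq_cube algebra_simps)
qed

text \<open>
The boundedness of the third derivative is given on the open half line only, so the value at \<open>0\<close>
enters the constant separately.
\<close>

lemma potential_deriv_expansion:
  assumes "admissible_potential f"
  obtains B where "continuous_on {0..} (deriv_on {0..} f)" and "0 \<le> B"
    and "\<And>r. 0 \<le> r \<Longrightarrow> \<bar>deriv_on {0..} f r - deriv_on {0..} f 0 - nderiv_on 2 {0..} f 0 * r\<bar> \<le> B * r\<^sup>2"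
proof -
  let ?d = "\<lambda>k. nderiv_on k {0..} f"
  have Ck: "Ck_on 3 {0..} f" and bdd: "bounded (?d 3 ` {0<..})"
    using assms by (auto simp: admissible_potential_def smooth_on_def)
  have d1: "(?d 1 has_real_derivative ?d 2 r) (at r within {0..})" if "r \<in> {0..}" for r
    using that Ck_on_has_derivative[OF Ck, of 1 r] by (simp add: numeral_2_eq_2)
  have d2: "(?d 2 has_real_derivative ?d 3 r) (at r within {0..})" if "r \<in> {0..}" for r
    using that Ck_on_has_derivative[OF Ck, of 2 r] by (simp add: eval_nat_numeral)
  obtain B0 where B0: "\<And>r. 0 < r \<Longrightarrow> \<bar>?d 3 r\<bar> \<le> B0"
    using bdd by (auto simp: bounded_iff)
  define B where "B = max B0 \<bar>?d 3 0\<bar>"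
  have B: "\<bar>?d 3 r\<bar> \<le> B" if "0 \<le> r" for r
    using B0[of r] that by (cases "r = 0") (auto simp: B_def)
  have cont: "continuous_on {0..} (?d 1)"
    using d1 by (intro DERIV_continuous_on) auto
  have exp: "\<bar>?d 1 r - ?d 1 0 - ?d 2 0 * r\<bar> \<le> B * r\<^sup>2" if "0 \<le> r" for r
  proof -
    have "\<bar>?d 1 r - ?d 1 0 - ?d 2 0 * (r - 0)\<bar> \<le> (B * r) * \<bar>r - 0\<bar>"
    proof (rule first_order_Taylor_bound[where S = "{0..}"])
      fix z :: real assume z: "z \<in> {0..}" "\<bar>z - 0\<bar> \<le> \<bar>r - 0\<bar>"
      have "\<bar>?d 2 z - ?d 2 0 - 0 * (z - 0)\<bar> \<le> B * \<bar>z - 0\<bar>"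
        by (rule first_order_Taylor_bound[where S = "{0..}", OF _ _ _ d2]) (use z B in auto)
      also have "\<dots> \<le> B * r" using z that B[of 0] by (intro mult_left_mono) auto
      finally show "\<bar>?d 2 z - ?d 2 0\<bar> \<le> B * r" by simp
    qed (use that d1 in auto)
    then show ?thesis using that by (simp add: power2_eq_square mult.assoc)
  qed
  have "0 \<le> B" by (simp add: B_def)
  with cont exp show ?thesis by (intro that[of B]) simp_all
qed

section \<open>Consistency of the peridynamic force\<close>

lemma set_integrable_bounded_Icc:
  fixes g :: "real \<Rightarrow> real"
  assumes "g \<in> borel_measurable lebesgue" and "\<And>z. z \<in> {c..d} \<Longrightarrow> \<bar>g z\<bar> \<le> K"
  shows "set_integrable lebesgue {c..d} g"
  unfolding set_integrable_def
  by (rule integrableI_bounded_set_indicator[where B = K]) (use assms in \<open>auto simp: emeasure_lborel_Icc_eq\<close>)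

lemma LINT_odd_eq_0:
  fixes g :: "real \<Rightarrow> real"
  assumes "\<And>z. g (- z) = - g z"
  shows "(LINT z:{-c..c}|lebesgue. g z) = 0"
proof -
  have "(LINT z:{-c..c}|lebesgue. g z) = (LINT z:{-c..c}|lebesgue. - g z)"
    unfolding set_lebesgue_integral_def
    by (subst lebesgue_integral_real_affine[where c = "-1" and t = 0])
      (auto simp: assms indicator_def intro!: Bochner_Integration.integral_cong)
  then show ?thesis by (simp add: set_lebesgue_integral_def)
qed

lemma pd_force_rescaled:
  assumes "0 < \<epsilon>"
  shows "pd_force f J \<epsilon> v x = 2 / \<epsilon> * (LINT z:{-1..1}|lebesgue.
    J \<bar>z\<bar> * (deriv_on {0..} f (\<bar>\<epsilon> * z\<bar> * (strain v (x + \<epsilon> * z) x)\<^sup>2) * strain v (x + \<epsilon> * z) x))"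
proof -
  have ind: "indicator {x - \<epsilon>..x + \<epsilon>} (x + \<epsilon> * z) = (indicator {-1..1} z :: real)" for z
  proof -
    have "(x - \<epsilon> \<le> x + \<epsilon> * z) = (- 1 \<le> z)" "(x + \<epsilon> * z \<le> x + \<epsilon>) = (z \<le> 1)"
      using assms mult_le_cancel_left_pos[of \<epsilon> "-1" z] mult_le_cancel_left_pos[of \<epsilon> z 1] by auto
    then show ?thesis by (simp add: indicator_def)
  qed
  have "pd_force f J \<epsilon> v x = 2 / \<epsilon>\<^sup>2 * (\<epsilon> * (LINT z:{-1..1}|lebesgue.
    J \<bar>z\<bar> * (deriv_on {0..} f (\<bar>\<epsilon> * z\<bar> * (strain v (x + \<epsilon> * z) x)\<^sup>2) * strain v (x + \<epsilon> * z) x)))"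
    unfolding pd_force_def set_lebesgue_integral_def
    by (subst lebesgue_integral_real_affine[where c = \<epsilon> and t = x])
      (use assms in \<open>simp_all add: ind abs_mult mult.assoc\<close>)
  then show ?thesis using assms by (simp add: power2_eq_square)
qed

text \<open>
Neither function has to be measurable: if one fails to be integrable, so does the other, and both
integrals are zero by convention.
\<close>

lemma set_lebesgue_integral_spike:
  fixes g g' :: "real \<Rightarrow> real"
  assumes "negligible N" and "\<And>y. y \<in> S - N \<Longrightarrow> g y = g' y"
  shows "(LINT y:S|lebesgue. g y) = (LINT y:S|lebesgue. g' y)"
proof -
  have iff: "set_integrable lebesgue S g \<longleftrightarrow> set_integrable lebesgue S g'"
    using assms by (intro absolutely_integrable_spike_eq[of N]) auto
  show ?thesis
  proof (cases "set_integrable lebesgue S g")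
    case True
    then show ?thesis
      using iff assms by (metis integral_spike set_lebesgue_integral_eq_integral(2))
  next
    case False
    then show ?thesis
      using iff by (simp add: set_integrable_def set_lebesgue_integral_def not_integrable_integral_eq)
  qed
qed

text \<open>
The domain of integration is the closed interval, while a nonlocal boundary condition controls the
displacement on an open set only; the two end points form a null set.
\<close>

lemma pd_force_cong_open:
  assumes "0 < \<epsilon>" and "\<And>y. \<bar>y - x\<bar> < \<epsilon> \<Longrightarrow> v y = w y"
  shows "pd_force f J \<epsilon> v x = pd_force f J \<epsilon> w x"
proof -
  have vw: "v x = w x" using assms by simp
  have "(LINT y:{x - \<epsilon>..x + \<epsilon>}|lebesgue. J (\<bar>y - x\<bar> / \<epsilon>) * deriv_on {0..} f (\<bar>y - x\<bar> * (strain v y x)\<^sup>2) * strain v y x)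
    = (LINT y:{x - \<epsilon>..x + \<epsilon>}|lebesgue. J (\<bar>y - x\<bar> / \<epsilon>) * deriv_on {0..} f (\<bar>y - x\<bar> * (strain w y x)\<^sup>2) * strain w y x)"
  proof (rule set_lebesgue_integral_spike)
    show "negligible {x - \<epsilon>, x + \<epsilon>}" by simp
    fix y assume "y \<in> {x - \<epsilon>..x + \<epsilon>} - {x - \<epsilon>, x + \<epsilon>}"
    then have "v y = w y" using assms(2)[of y] by auto
    then have "strain v y x = strain w y x" using vw by (simp add: strain_def)
    then show "J (\<bar>y - x\<bar> / \<epsilon>) * deriv_on {0..} f (\<bar>y - x\<bar> * (strain v y x)\<^sup>2) * strain v y x
      = J (\<bar>y - x\<bar> / \<epsilon>) * deriv_on {0..} f (\<bar>y - x\<bar> * (strain w y x)\<^sup>2) * strain w y x" by simp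
  qed
  then show ?thesis by (simp add: pd_force_def)
qed

text \<open>
Displacements with uniform bounds up to the third derivative, the regularity consumed by the
consistency estimate. One constant \<open>V\<close> for all bounds keeps the final constant explicit.
\<close>

locale smooth_profile =
  fixes v v1 v2 :: "real \<Rightarrow> real" and V :: real
  assumes v: "\<And>z. (v has_real_derivative v1 z) (at z)"
    and v1: "\<And>z. (v1 has_real_derivative v2 z) (at z)"
    and v1_bound: "\<And>z. \<bar>v1 z\<bar> \<le> V"
    and v2_bound: "\<And>z. \<bar>v2 z\<bar> \<le> V"
    and v2_lipschitz: "\<And>y z. \<bar>v2 y - v2 z\<bar> \<le> V * \<bar>y - z\<bar>"
begin

lemma strain_bound: "\<bar>strain v y x\<bar> \<le> V"
proof (cases "y = x")
  case True
  then show ?thesis using v1_bound[of 0] by (simp add: strain_def)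
next
  case False
  have "\<bar>v y - v x - 0 * (y - x)\<bar> \<le> V * \<bar>y - x\<bar>"
    by (rule first_order_Taylor_bound[where S = UNIV]) (use v v1_bound in auto)
  then show ?thesis using False by (simp add: strain_def divide_le_eq)
qed

text \<open>
For positive \<open>h\<close> the strain is the difference quotient, for negative \<open>h\<close> its negative; hence the
sign, which decides below which terms are odd.
\<close>

lemma strain_expansion:
  assumes "h \<noteq> 0"
  shows "\<bar>strain v (x + h) x - sgn h * v1 x\<bar> \<le> V * \<bar>h\<bar>"
    and "\<bar>strain v (x + h) x - sgn h * (v1 x + h * v2 x / 2)\<bar> \<le> V * h\<^sup>2"
proof -
  have h: "\<bar>h\<bar> > 0" "h = sgn h * \<bar>h\<bar>" using assms by (auto simp: sgn_mult_abs)
  have *: "\<bar>v (x + h) - v x - v1 x * (x + h - x)\<bar> \<le> (V * \<bar>h\<bar>) * \<bar>x + h - x\<bar>"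
  proof (rule first_order_Taylor_bound[where S = UNIV])
    fix z assume z: "\<bar>z - x\<bar> \<le> \<bar>x + h - x\<bar>"
    have "\<bar>v1 z - v1 x - 0 * (z - x)\<bar> \<le> V * \<bar>z - x\<bar>"
      by (rule first_order_Taylor_bound[where S = UNIV]) (use v1 v2_bound in auto)
    also have "\<dots> \<le> V * \<bar>h\<bar>" using z v1_bound[of 0] by (intro mult_left_mono) auto
    finally show "\<bar>v1 z - v1 x\<bar> \<le> V * \<bar>h\<bar>" by simp
  qed (use v in auto)
  have sh: "strain v (x + h) x * \<bar>h\<bar> = v (x + h) - v x"
    using h by (simp add: strain_def)
  have "(strain v (x + h) x - sgn h * v1 x) * \<bar>h\<bar> = v (x + h) - v x - v1 x * h"
  proof -
    have "sgn h * v1 x * \<bar>h\<bar> = v1 x * (sgn h * \<bar>h\<bar>)" by (simp only: mult_ac)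
    then show ?thesis using sh unfolding h(2)[symmetric] left_diff_distrib by linarith
  qed
  then have "\<bar>strain v (x + h) x - sgn h * v1 x\<bar> * \<bar>h\<bar> \<le> (V * \<bar>h\<bar>) * \<bar>h\<bar>"
    using * by (simp flip: abs_mult)
  then show "\<bar>strain v (x + h) x - sgn h * v1 x\<bar> \<le> V * \<bar>h\<bar>"
    using h(1) by (rule mult_right_le_imp_le)
  have **: "\<bar>v (x + h) - v x - v1 x * h - v2 x * h\<^sup>2 / 2\<bar> \<le> V * \<bar>h\<bar> ^ 3"
    by (rule second_order_Taylor_bound) (use v v1 v2_lipschitz in auto)
  have "sgn h * (v1 x + h * v2 x / 2) * \<bar>h\<bar> = (v1 x + h * v2 x / 2) * (sgn h * \<bar>h\<bar>)"
    by (simp only: mult_ac)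
  also have "\<dots> = v1 x * h + v2 x * h\<^sup>2 / 2"
    unfolding h(2)[symmetric] by (simp add: algebra_simps power2_eq_square)
  finally have "(strain v (x + h) x - sgn h * (v1 x + h * v2 x / 2)) * \<bar>h\<bar>
      = v (x + h) - v x - v1 x * h - v2 x * h\<^sup>2 / 2"
    using sh by (simp add: left_diff_distrib)
  then have "\<bar>strain v (x + h) x - sgn h * (v1 x + h * v2 x / 2)\<bar> * \<bar>h\<bar> \<le> V * \<bar>h\<bar> ^ 3"
    using ** by (simp flip: abs_mult)
  also have "\<dots> = (V * h\<^sup>2) * \<bar>h\<bar>"
    by (simp add: power3_eq_cube power2_eq_square)
  finally show "\<bar>strain v (x + h) x - sgn h * (v1 x + h * v2 x / 2)\<bar> \<le> V * h\<^sup>2"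
    using h(1) by (rule mult_right_le_imp_le)
qed

text \<open>
Here \<open>d\<close> stands for \<open>f'\<close>, so \<open>d0\<close> and \<open>A\<close> are \<open>f'(0)\<close> and \<open>f''(0)\<close>. The expansion is
arranged as an even part in \<open>h\<close>, which produces the elastic force, and an odd part.
\<close>

lemma force_density_expansion:
  fixes d :: "real \<Rightarrow> real"
  assumes "0 \<le> B" and d: "\<And>r. 0 \<le> r \<Longrightarrow> \<bar>d r - d0 - A * r\<bar> \<le> B * r\<^sup>2"
  shows "\<bar>d (\<bar>h\<bar> * (strain v (x + h) x)\<^sup>2) * strain v (x + h) x
           - (d0 * v2 x / 2 * \<bar>h\<bar> + sgn h * (d0 * v1 x + A * \<bar>h\<bar> * v1 x ^ 3))\<bar>
         \<le> (\<bar>d0\<bar> * V + 3 * \<bar>A\<bar> * V ^ 3 + B * V ^ 5) * h\<^sup>2"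
proof (cases "h = 0")
  case True
  then show ?thesis by (simp add: strain_def)
next
  case False
  (* The remainder is the sum of three errors: of d, of the strain multiplying d0, and of replacing
     the cube of the strain s by the cube of its leading term p. *)
  define s where "s = strain v (x + h) x"
  define p where "p = sgn h * v1 x"
  have V: "0 \<le> V" using v1_bound[of 0] by simp
  have s: "\<bar>s\<bar> \<le> V" and p: "\<bar>p\<bar> \<le> V"
    using strain_bound v1_bound[of x] by (auto simp: s_def p_def abs_mult sgn_if)
  have p3: "p ^ 3 = sgn h * v1 x ^ 3"
    by (simp add: p_def power_mult_distrib power3_eq_cube sgn_if)
  have 1: "\<bar>(d (\<bar>h\<bar> * s\<^sup>2) - d0 - A * (\<bar>h\<bar> * s\<^sup>2)) * s\<bar> \<le> (B * V ^ 5) * h\<^sup>2"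
  proof -
    have s4: "s ^ 4 \<le> V ^ 4" using s power_mono[of "\<bar>s\<bar>" V 4] by simp
    have "\<bar>d (\<bar>h\<bar> * s\<^sup>2) - d0 - A * (\<bar>h\<bar> * s\<^sup>2)\<bar> \<le> B * (\<bar>h\<bar> * s\<^sup>2)\<^sup>2"
      by (rule d) simp
    also have "\<dots> = (B * h\<^sup>2) * s ^ 4" by (simp add: power_mult_distrib)
    also have "\<dots> \<le> (B * h\<^sup>2) * V ^ 4"
      using s4 \<open>0 \<le> B\<close> by (intro mult_left_mono) auto
    finally have "\<bar>d (\<bar>h\<bar> * s\<^sup>2) - d0 - A * (\<bar>h\<bar> * s\<^sup>2)\<bar> * \<bar>s\<bar> \<le> (B * h\<^sup>2) * V ^ 4 * V"
      using s \<open>0 \<le> B\<close> V by (intro mult_mono) auto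
    also have "\<dots> = (B * V ^ 5) * h\<^sup>2" by (simp add: power_numeral_reduce)
    finally show ?thesis by (simp only: abs_mult)
  qed
  have 2: "\<bar>d0 * (s - sgn h * (v1 x + h * v2 x / 2))\<bar> \<le> (\<bar>d0\<bar> * V) * h\<^sup>2"
    using mult_left_mono[OF strain_expansion(2)[OF False, of x], of "\<bar>d0\<bar>"]
    by (simp add: abs_mult s_def mult.assoc)
  have 3: "\<bar>A * \<bar>h\<bar> * (s ^ 3 - p ^ 3)\<bar> \<le> (3 * \<bar>A\<bar> * V ^ 3) * h\<^sup>2"
  proof -
    have "\<bar>s\<^sup>2 + s * p + p\<^sup>2\<bar> \<le> \<bar>s\<bar> * \<bar>s\<bar> + \<bar>s\<bar> * \<bar>p\<bar> + \<bar>p\<bar> * \<bar>p\<bar>"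
      using abs_triangle_ineq[of "s\<^sup>2 + s * p" "p\<^sup>2"] abs_triangle_ineq[of "s\<^sup>2" "s * p"]
      by (simp add: abs_mult power2_eq_square)
    also have "\<dots> \<le> V * V + V * V + V * V"
      using s p V by (intro add_mono mult_mono) auto
    finally have "\<bar>s - p\<bar> * \<bar>s\<^sup>2 + s * p + p\<^sup>2\<bar> \<le> (V * \<bar>h\<bar>) * (3 * V\<^sup>2)"
      using strain_expansion(1)[OF False, of x] V
      by (intro mult_mono) (auto simp: s_def p_def power2_eq_square)
    also have "\<bar>s - p\<bar> * \<bar>s\<^sup>2 + s * p + p\<^sup>2\<bar> = \<bar>s ^ 3 - p ^ 3\<bar>"
      by (simp add: abs_mult[symmetric] algebra_simps power2_eq_square power3_eq_cube)
    finally have "(\<bar>A\<bar> * \<bar>h\<bar>) * \<bar>s ^ 3 - p ^ 3\<bar> \<le> (\<bar>A\<bar> * \<bar>h\<bar>) * ((V * \<bar>h\<bar>) * (3 * V\<^sup>2))"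
      by (intro mult_left_mono) auto
    also have "\<dots> = (3 * \<bar>A\<bar> * V ^ 3) * \<bar>h\<bar>\<^sup>2"
      by (simp only: power2_eq_square power3_eq_cube mult_ac)
    finally show ?thesis by (simp add: abs_mult)
  qed
  have "d (\<bar>h\<bar> * s\<^sup>2) * s - (d0 * v2 x / 2 * \<bar>h\<bar> + sgn h * (d0 * v1 x + A * \<bar>h\<bar> * v1 x ^ 3))
      = (d (\<bar>h\<bar> * s\<^sup>2) - d0 - A * (\<bar>h\<bar> * s\<^sup>2)) * s
        + d0 * (s - sgn h * (v1 x + h * v2 x / 2)) + A * \<bar>h\<bar> * (s ^ 3 - p ^ 3)"
  proof -
    have "h * sgn h = \<bar>h\<bar>" by (simp add: abs_sgn)
    then show ?thesis unfolding p3 by (simp add: algebra_simps power2_eq_square power3_eq_cube)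
  qed
  moreover have "\<bar>x1 + x2 + x3\<bar> \<le> (k2 + k3 + k1) * h\<^sup>2"
    if "\<bar>x1\<bar> \<le> k1 * h\<^sup>2" "\<bar>x2\<bar> \<le> k2 * h\<^sup>2" "\<bar>x3\<bar> \<le> k3 * h\<^sup>2" for x1 x2 x3 k1 k2 k3 :: real
    using that abs_triangle_ineq[of "x1 + x2" x3] abs_triangle_ineq[of x1 x2]
    by (simp add: distrib_right)
  ultimately show ?thesis
    using 1 2 3 unfolding s_def[symmetric] by metis
qed

text \<open>
The integral of the remainder is at most \<open>2 M\<close> times its supremum of order \<open>\<epsilon>\<^sup>2\<close>, and the
prefactor \<open>2 / \<epsilon>\<close> leaves one power of \<open>\<epsilon>\<close>.
\<close>

lemma pd_force_consistency:
  assumes eps: "0 < \<epsilon>" and J: "admissible_influence M J"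
    and cont: "continuous_on {0..} (deriv_on {0..} f)" and B: "0 \<le> B"
    and d: "\<And>r. 0 \<le> r \<Longrightarrow> \<bar>deriv_on {0..} f r - deriv_on {0..} f 0 - A * r\<bar> \<le> B * r\<^sup>2"
  shows "\<bar>pd_force f J \<epsilon> v x - youngs_modulus f J * v2 x\<bar>
    \<le> 4 * M * (\<bar>deriv_on {0..} f 0\<bar> * V + 3 * \<bar>A\<bar> * V ^ 3 + B * V ^ 5) * \<epsilon>"
proof -
  define K where "K = \<bar>deriv_on {0..} f 0\<bar> * V + 3 * \<bar>A\<bar> * V ^ 3 + B * V ^ 5"
  let ?d = "deriv_on {0..} f"
  (* F is the rescaled force density without its weight, G1 and G2 the even and
     the odd part of its expansion. *)
  define F where "F z = ?d (\<bar>\<epsilon> * z\<bar> * (strain v (x + \<epsilon> * z) x)\<^sup>2) * strain v (x + \<epsilon> * z) x" for z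
  define G1 where "G1 z = ?d 0 * v2 x / 2 * \<bar>\<epsilon> * z\<bar>" for z
  define G2 where "G2 z = sgn (\<epsilon> * z) * (?d 0 * v1 x + A * \<bar>\<epsilon> * z\<bar> * v1 x ^ 3)" for z
  have V: "0 \<le> V" using v1_bound[of 0] by simp
  then have K: "0 \<le> K" using B by (simp add: K_def)
  have Jm: "(\<lambda>z. J \<bar>z\<bar>) \<in> borel_measurable lebesgue"
    using J by (auto simp: admissible_influence_def)
  have Jb: "0 \<le> J \<bar>z\<bar>" "J \<bar>z\<bar> \<le> M" if "z \<in> {-1..1}" for z
    using J that by (auto simp: admissible_influence_def)
  have M: "0 \<le> M" using Jb[of 0] by simp
  have vc: "continuous_on UNIV v"
    by (rule DERIV_continuous_on) (use v in auto)
  have Fm: "F \<in> borel_measurable lebesgue"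
  proof -
    have [measurable]: "v \<in> borel_measurable borel"
      using vc by (rule borel_measurable_continuous_onI)
    (* f' is only known to be continuous on the half line; max makes it continuous everywhere
       without changing F, where the argument is nonnegative. *)
    have "continuous_on UNIV (\<lambda>r. ?d (max 0 r))"
      by (rule continuous_on_compose2[OF cont]) (auto intro!: continuous_intros)
    then have [measurable]: "(\<lambda>r. ?d (max 0 r)) \<in> borel_measurable borel"
      by (rule borel_measurable_continuous_onI)
    have "(\<lambda>z. ?d (max 0 (\<bar>\<epsilon> * z\<bar> * (strain v (x + \<epsilon> * z) x)\<^sup>2)) * strain v (x + \<epsilon> * z) x) \<in> borel_measurable lborel"
      unfolding strain_def by measurable
    moreover have "(\<lambda>z. ?d (max 0 (\<bar>\<epsilon> * z\<bar> * (strain v (x + \<epsilon> * z) x)\<^sup>2)) * strain v (x + \<epsilon> * z) x) = F"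
      by (auto simp: F_def max_def fun_eq_iff)
    ultimately show ?thesis using measurable_completion by metis
  qed
  have G1m: "G1 \<in> borel_measurable lebesgue" and G2m: "G2 \<in> borel_measurable lebesgue"
    unfolding G1_def[abs_def] G2_def[abs_def] by (auto intro!: measurable_completion)
  have FG: "\<bar>F z - (G1 z + G2 z)\<bar> \<le> K * \<epsilon>\<^sup>2" if "z \<in> {-1..1}" for z
  proof -
    have "\<bar>F z - (G1 z + G2 z)\<bar> \<le> K * (\<epsilon> * z)\<^sup>2"
      unfolding F_def G1_def G2_def K_def by (rule force_density_expansion[OF B d])
    also have "\<dots> \<le> K * \<epsilon>\<^sup>2"
      using that K mult_left_le[of "z\<^sup>2" "\<epsilon>\<^sup>2"] abs_square_le_1[of z]
      by (intro mult_left_mono) (auto simp: power_mult_distrib)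
    finally show ?thesis .
  qed
  have G1b: "\<bar>G1 z\<bar> \<le> \<bar>?d 0 * v2 x / 2\<bar> * \<epsilon>" if "z \<in> {-1..1}" for z
    using that abs_le_iff[of z 1] eps mult_left_mono[of "\<bar>z\<bar>" 1 "\<bar>?d 0 * v2 x / 2\<bar> * \<epsilon>"]
    by (simp add: G1_def abs_mult mult.assoc)
  have G2b: "\<bar>G2 z\<bar> \<le> \<bar>?d 0 * v1 x\<bar> + \<bar>A * v1 x ^ 3\<bar> * \<epsilon>" if "z \<in> {-1..1}" for z
  proof -
    have "\<bar>G2 z\<bar> \<le> \<bar>?d 0 * v1 x + A * \<bar>\<epsilon> * z\<bar> * v1 x ^ 3\<bar>"
      by (auto simp: G2_def abs_mult sgn_if)
    also have "\<dots> \<le> \<bar>?d 0 * v1 x\<bar> + \<bar>A * v1 x ^ 3\<bar> * (\<epsilon> * \<bar>z\<bar>)"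
      using abs_triangle_ineq[of "?d 0 * v1 x" "A * \<bar>\<epsilon> * z\<bar> * v1 x ^ 3"] eps
      by (simp add: abs_mult mult.assoc mult.left_commute mult.commute)
    also have "\<dots> \<le> \<bar>?d 0 * v1 x\<bar> + \<bar>A * v1 x ^ 3\<bar> * \<epsilon>"
      using that eps by (intro add_left_mono mult_left_mono) auto
    finally show ?thesis .
  qed
  have weighted: "\<bar>J \<bar>z\<bar> * g z\<bar> \<le> M * k" if "z \<in> {-1..1}" "\<bar>g z\<bar> \<le> k" for g k z
    unfolding abs_mult using that Jb[OF that(1)] M by (intro mult_mono) auto
  have weighted_integrable: "set_integrable lebesgue {-1..1} (\<lambda>z. J \<bar>z\<bar> * g z)"
    if "g \<in> borel_measurable lebesgue" "\<And>z. z \<in> {-1..1} \<Longrightarrow> \<bar>g z\<bar> \<le> k" for g k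
    using weighted[where g = g and k = k] that
    by (intro set_integrable_bounded_Icc[where K = "M * k"] borel_measurable_times Jm) auto
  have JG1: "set_integrable lebesgue {-1..1} (\<lambda>z. J \<bar>z\<bar> * G1 z)"
    by (rule weighted_integrable[OF G1m G1b])
  have JG2: "set_integrable lebesgue {-1..1} (\<lambda>z. J \<bar>z\<bar> * G2 z)"
    by (rule weighted_integrable[OF G2m G2b])
  have JR: "set_integrable lebesgue {-1..1} (\<lambda>z. J \<bar>z\<bar> * (F z - (G1 z + G2 z)))"
    by (rule weighted_integrable[OF _ FG]) (intro borel_measurable_diff borel_measurable_add Fm G1m G2m)
  have "(LINT z:{-1..1}|lebesgue. J \<bar>z\<bar> * F z)
      = (LINT z:{-1..1}|lebesgue. J \<bar>z\<bar> * (F z - (G1 z + G2 z)) + (J \<bar>z\<bar> * G1 z + J \<bar>z\<bar> * G2 z))"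
    by (simp add: algebra_simps)
  also have "\<dots> = (LINT z:{-1..1}|lebesgue. J \<bar>z\<bar> * (F z - (G1 z + G2 z)))
      + ((LINT z:{-1..1}|lebesgue. J \<bar>z\<bar> * G1 z) + (LINT z:{-1..1}|lebesgue. J \<bar>z\<bar> * G2 z))"
    using JR JG1 JG2 by (simp add: set_integral_add)
  also have "(LINT z:{-1..1}|lebesgue. J \<bar>z\<bar> * G2 z) = 0"
    by (rule LINT_odd_eq_0) (simp add: G2_def sgn_mult sgn_minus)
  also have "(LINT z:{-1..1}|lebesgue. J \<bar>z\<bar> * G1 z) = \<epsilon> / 2 * (youngs_modulus f J * v2 x)"
  proof -
    have "(LINT z:{-1..1}|lebesgue. J \<bar>z\<bar> * G1 z)
        = (LINT z:{-1..1}|lebesgue. (\<epsilon> / 2 * v2 x) * (J \<bar>z\<bar> * ?d 0 * \<bar>z\<bar>))"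
      using eps by (simp add: G1_def abs_mult algebra_simps)
    then show ?thesis by (simp add: youngs_modulus_def)
  qed
  finally have eq: "pd_force f J \<epsilon> v x - youngs_modulus f J * v2 x
      = 2 / \<epsilon> * (LINT z:{-1..1}|lebesgue. J \<bar>z\<bar> * (F z - (G1 z + G2 z)))"
    using eps unfolding pd_force_rescaled[OF eps] F_def[symmetric]
    by (simp add: distrib_left)
  have "norm (LINT z:{-1..1}|lebesgue. J \<bar>z\<bar> * (F z - (G1 z + G2 z)))
      \<le> (LINT z:{-1..1}|lebesgue. norm (J \<bar>z\<bar> * (F z - (G1 z + G2 z))))"
    by (rule set_integral_norm_bound[OF JR])
  also have "\<dots> \<le> (LINT z:{-1..1::real}|lebesgue. M * (K * \<epsilon>\<^sup>2))"
  proof (rule set_integral_mono)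
    show "set_integrable lebesgue {-1..1} (\<lambda>z. norm (J \<bar>z\<bar> * (F z - (G1 z + G2 z))))"
      using JR by (rule set_integrable_norm)
    show "set_integrable lebesgue {-1..1::real} (\<lambda>z. M * (K * \<epsilon>\<^sup>2))"
      by (rule set_integrable_bounded_Icc) auto
    fix z :: real assume "z \<in> {-1..1}"
    then show "norm (J \<bar>z\<bar> * (F z - (G1 z + G2 z))) \<le> M * (K * \<epsilon>\<^sup>2)"
      unfolding real_norm_def by (intro weighted FG)
  qed
  also have "\<dots> = 2 * (M * (K * \<epsilon>\<^sup>2))" by (simp add: set_lebesgue_integral_def)
  finally have "2 / \<epsilon> * \<bar>LINT z:{-1..1}|lebesgue. J \<bar>z\<bar> * (F z - (G1 z + G2 z))\<bar>
      \<le> 2 / \<epsilon> * (2 * (M * (K * \<epsilon>\<^sup>2)))"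
    using eps by (intro mult_left_mono) auto
  also have "\<dots> = 4 * M * K * \<epsilon>"
    using eps by (simp add: power2_eq_square)
  finally show ?thesis
    using eps unfolding eq K_def[symmetric] by (simp add: abs_mult)
qed

end

section \<open>Interpolation, integration by parts, Gronwall\<close>

text \<open>
The symmetric second difference quotients with step \<open>h\<close> are jointly continuous and differ from the
second derivative by at most \<open>2 V h\<close>, uniformly in both variables.
\<close>

lemma second_derivative_jointly_continuous:
  fixes v v1 v2 :: "real \<Rightarrow> real \<Rightarrow> real"
  assumes prof: "\<And>s. s \<in> S \<Longrightarrow> smooth_profile (v s) (v1 s) (v2 s) V"
    and cont: "continuous_on (S \<times> UNIV) (\<lambda>(s, x). v s x)"
  shows "continuous_on (S \<times> UNIV) (\<lambda>(s, x). v2 s x)"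
proof -
  define h where "h n = 1 / real (Suc n)" for n
  have h: "0 < h n" for n by (simp add: h_def)
  define q where "q n = (\<lambda>(s, x). (v s (x + h n) + v s (x + - h n) - 2 * v s (x + 0)) / (h n)\<^sup>2)" for n
  have shift: "continuous_on (S \<times> UNIV) (\<lambda>p. v (fst p) (snd p + c))" for c
  proof -
    have "continuous_on (S \<times> UNIV) (\<lambda>p. (\<lambda>(s, x). v s x) (fst p, snd p + c))"
      by (rule continuous_on_compose2[OF cont]) (auto intro!: continuous_intros)
    then show ?thesis by simp
  qed
  show ?thesis
  proof (rule uniform_limit_theorem[where F = sequentially and f = q])
    have "continuous_on (S \<times> UNIV) (q n)" for n
    proof -
      have "continuous_on (S \<times> UNIV) (\<lambda>p. (v (fst p) (snd p + h n) + v (fst p) (snd p + - h n)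
          - 2 * v (fst p) (snd p + 0)) / (h n)\<^sup>2)"
        using h[of n] by (intro continuous_intros shift) auto
      then show ?thesis by (simp add: q_def split_beta)
    qed
    then show "\<forall>\<^sub>F n in sequentially. continuous_on (S \<times> UNIV) (q n)" by simp
    show "uniform_limit (S \<times> UNIV) q (\<lambda>(s, x). v2 s x) sequentially"
    proof (rule uniform_limitI)
      fix r :: real assume "0 < r"
      moreover have "(\<lambda>n. 2 * V / Suc n) \<longlonglongrightarrow> 0"
        by (rule LIMSEQ_Suc) (rule lim_const_over_n)
      ultimately have "\<forall>\<^sub>F n in sequentially. 2 * V / Suc n < r"
        by (rule order_tendstoD(2)[rotated])
      have close: "dist (q n (s, x)) (v2 s x) \<le> 2 * V / Suc n" if "s \<in> S" for n s x
      proof -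
        interpret smooth_profile "v s" "v1 s" "v2 s" V by (rule prof[OF that])
        have "\<bar>v s (x + k) - v s x - v1 s x * k - v2 s x * k\<^sup>2 / 2\<bar> \<le> V * \<bar>k\<bar> ^ 3" for k
          by (rule second_order_Taylor_bound) (use v v1 v2_lipschitz in auto)
        from this[of "h n"] this[of "- h n"]
        have "\<bar>v s (x + h n) + v s (x + - h n) - 2 * v s (x + 0) - v2 s x * (h n)\<^sup>2\<bar> \<le> 2 * V * h n ^ 3"
          using h[of n] by simp
        also have "v s (x + h n) + v s (x + - h n) - 2 * v s (x + 0) - v2 s x * (h n)\<^sup>2
            = (q n (s, x) - v2 s x) * (h n)\<^sup>2"
        proof -
          have "q n (s, x) * (h n)\<^sup>2 = v s (x + h n) + v s (x + - h n) - 2 * v s (x + 0)"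
            using h[of n] by (simp add: q_def)
          then show ?thesis by (simp only: left_diff_distrib)
        qed
        also have "2 * V * h n ^ 3 = (2 * V / Suc n) * (h n)\<^sup>2"
          by (simp add: h_def power2_eq_square power3_eq_cube)
        finally have "\<bar>q n (s, x) - v2 s x\<bar> * (h n)\<^sup>2 \<le> (2 * V / Suc n) * (h n)\<^sup>2"
          by (simp add: abs_mult)
        moreover have "0 < (h n)\<^sup>2" using h[of n] by simp
        ultimately show ?thesis unfolding dist_real_def by (rule mult_right_le_imp_le)
      qed
      with \<open>\<forall>\<^sub>F n in sequentially. 2 * V / Suc n < r\<close>
      show "\<forall>\<^sub>F n in sequentially. \<forall>p\<in>S \<times> UNIV. dist (q n p) (case p of (s, x) \<Rightarrow> v2 s x) < r"
        by (elim eventually_mono) (auto intro: le_less_trans[OF close])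
    qed
  qed simp
qed

lemma integral_by_parts_zero_boundary:
  fixes p p' q q' :: "real \<Rightarrow> real"
  assumes "a \<le> b"
    and p: "\<And>x. x \<in> {a..b} \<Longrightarrow> (p has_real_derivative p' x) (at x within {a..b})"
    and q: "\<And>x. x \<in> {a..b} \<Longrightarrow> (q has_real_derivative q' x) (at x within {a..b})"
    and "p a * q a = 0" and "p b * q b = 0"
    and q': "continuous_on {a..b} q'" and p': "continuous_on {a..b} p'"
  shows "integral {a..b} (\<lambda>x. p' x * q x) = - integral {a..b} (\<lambda>x. p x * q' x)"
proof -
  have pc: "continuous_on {a..b} p" and qc: "continuous_on {a..b} q"
    by (auto intro: DERIV_continuous_on[OF p] DERIV_continuous_on[OF q])
  have "((\<lambda>x. p' x * q x + p x * q' x) has_integral p b * q b - p a * q a) {a..b}"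
  proof (rule fundamental_theorem_of_calculus[OF \<open>a \<le> b\<close>])
    fix x assume x: "x \<in> {a..b}"
    show "((\<lambda>x. p x * q x) has_vector_derivative p' x * q x + p x * q' x) (at x within {a..b})"
      unfolding has_real_derivative_iff_has_vector_derivative[symmetric]
      by (rule derivative_eq_intros p[OF x] q[OF x] refl | simp)+
  qed
  then have "integral {a..b} (\<lambda>x. p' x * q x + p x * q' x) = 0"
    using assms by (simp add: integral_unique)
  moreover have "(\<lambda>x. p' x * q x) integrable_on {a..b}" "(\<lambda>x. p x * q' x) integrable_on {a..b}"
    using pc qc p' q' by (auto intro!: integrable_continuous_real continuous_intros)
  ultimately show ?thesis by (simp add: integral_add)
qed

text \<open>
Integrating by parts against the weight \<open>x - a\<close>, which vanishes at \<open>a\<close>, turns the integral of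
\<open>p\<^sup>2\<close> into that of \<open>- 2 (x - a) p p'\<close>. Young's inequality absorbs half of it on the left.
\<close>

lemma Poincare_inequality:
  fixes p p' :: "real \<Rightarrow> real"
  assumes "a \<le> b"
    and p: "\<And>x. x \<in> {a..b} \<Longrightarrow> (p has_real_derivative p' x) (at x within {a..b})"
    and p': "continuous_on {a..b} p'" and bc: "p b = 0"
  shows "integral {a..b} (\<lambda>x. (p x)\<^sup>2) \<le> 4 * (b - a)\<^sup>2 * integral {a..b} (\<lambda>x. (p' x)\<^sup>2)"
proof -
  have pc: "continuous_on {a..b} p" by (rule DERIV_continuous_on[OF p])
  have "integral {a..b} (\<lambda>x. 1 * (p x)\<^sup>2) = - integral {a..b} (\<lambda>x. (x - a) * (2 * p x * p' x))"
    by (rule integral_by_parts_zero_boundary)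
      (auto intro!: derivative_eq_intros p continuous_intros pc p' simp: assms)
  also have "\<dots> = integral {a..b} (\<lambda>x. - ((x - a) * (2 * p x * p' x)))"
    by simp
  also have "\<dots> \<le> integral {a..b} (\<lambda>x. (p x)\<^sup>2 / 2 + 2 * (b - a)\<^sup>2 * (p' x)\<^sup>2)"
  proof (rule integral_le)
    fix x assume x: "x \<in> {a..b}"
    have "0 \<le> (p x + 2 * ((x - a) * p' x))\<^sup>2 / 2" by simp
    also have "\<dots> = (p x)\<^sup>2 / 2 + 2 * ((x - a)\<^sup>2 * (p' x)\<^sup>2) + (x - a) * (2 * p x * p' x)"
      by (simp add: power2_eq_square field_simps)
    finally have "- ((x - a) * (2 * p x * p' x)) \<le> (p x)\<^sup>2 / 2 + 2 * ((x - a)\<^sup>2 * (p' x)\<^sup>2)" by linarith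
    also have "(x - a)\<^sup>2 * (p' x)\<^sup>2 \<le> (b - a)\<^sup>2 * (p' x)\<^sup>2"
      using x by (intro mult_right_mono power_mono) auto
    finally show "- ((x - a) * (2 * p x * p' x)) \<le> (p x)\<^sup>2 / 2 + 2 * (b - a)\<^sup>2 * (p' x)\<^sup>2" by simp
  qed (auto intro!: integrable_continuous_real continuous_intros pc p')
  also have "\<dots> = integral {a..b} (\<lambda>x. (p x)\<^sup>2) / 2 + 2 * (b - a)\<^sup>2 * integral {a..b} (\<lambda>x. (p' x)\<^sup>2)"
    by (subst integral_add) (auto intro!: integrable_continuous_real continuous_intros pc p')
  finally show ?thesis by simp
qed

lemma Gronwall_unit_rate:
  fixes \<phi> \<phi>' :: "real \<Rightarrow> real"
  assumes der: "\<And>s. s \<in> {0..T} \<Longrightarrow> (\<phi> has_real_derivative \<phi>' s) (at s within {0..T})"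
    and le: "\<And>s. s \<in> {0..T} \<Longrightarrow> \<phi>' s \<le> \<phi> s + c"
    and "\<phi> 0 = 0" and t: "t \<in> {0..T}"
  shows "\<phi> t \<le> c * (exp t - 1)"
proof -
  have cont: "continuous_on {0..T} \<phi>" using der by (rule DERIV_continuous_on)
  have "exp (- t) * (\<phi> t + c) \<le> exp (- 0) * (\<phi> 0 + c)"
  proof (rule DERIV_nonpos_imp_decreasing_open[where f = "\<lambda>s. exp (- s) * (\<phi> s + c)"])
    fix s assume s: "0 < s" "s < t"
    have "(\<phi> has_real_derivative \<phi>' s) (at s)"
      using der[of s] s t at_within_Icc_at[of 0 s T] by auto
    then have "((\<lambda>s. exp (- s) * (\<phi> s + c)) has_real_derivative exp (- s) * (\<phi>' s - (\<phi> s + c))) (at s)"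
      by (auto intro!: derivative_eq_intros simp: algebra_simps)
    moreover have "exp (- s) * (\<phi>' s - (\<phi> s + c)) \<le> 0"
      using le[of s] s t by (auto intro!: mult_nonneg_nonpos)
    ultimately show "\<exists>y. ((\<lambda>s. exp (- s) * (\<phi> s + c)) has_real_derivative y) (at s) \<and> y \<le> 0"
      by blast
  next
    have "continuous_on {0..t} \<phi>" using cont t by (auto intro: continuous_on_subset)
    then show "continuous_on {0..t} (\<lambda>s. exp (- s) * (\<phi> s + c))" by (intro continuous_intros)
  qed (use t in auto)
  then have "exp t * (exp (- t) * (\<phi> t + c)) \<le> exp t * c"
    using assms(3) by simp
  moreover have "exp t * (exp (- t) * (\<phi> t + c)) = \<phi> t + c"
    by (simp only: mult.assoc[symmetric] exp_minus_inverse mult_1)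
  ultimately show ?thesis by (simp add: right_diff_distrib mult.commute)
qed

section \<open>Energy estimate\<close>

lemma continuous_on_section:
  fixes F :: "real \<Rightarrow> real \<Rightarrow> real"
  assumes "continuous_on (S \<times> {a..b}) (\<lambda>(s, x). F s x)" and "s \<in> S"
  shows "continuous_on {a..b} (F s)"
proof -
  have "continuous_on {a..b} (\<lambda>x. (\<lambda>(s, x). F s x) (s, x))"
    by (rule continuous_on_compose2[OF assms(1)]) (use assms(2) in \<open>auto intro!: continuous_intros\<close>)
  then show ?thesis by simp
qed

text \<open>
The regularity common to both displacements, and hence to their difference. The mixed
derivative \<open>e_tx\<close> is left out because functions that are regular in time and in space separately
need not have one.
\<close>

locale wave_regular =
  fixes a b T :: real and e et ex exx :: "real \<Rightarrow> real \<Rightarrow> real"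
  assumes ab: "a < b"
    and e_t: "\<And>s x. s \<in> {0..T} \<Longrightarrow> x \<in> {a..b} \<Longrightarrow>
      ((\<lambda>s. e s x) has_real_derivative et s x) (at s within {0..T})"
    and e_x: "\<And>s x. s \<in> {0..T} \<Longrightarrow> x \<in> {a..b} \<Longrightarrow>
      (e s has_real_derivative ex s x) (at x within {a..b})"
    and e_xx: "\<And>s x. s \<in> {0..T} \<Longrightarrow> x \<in> {a..b} \<Longrightarrow>
      (ex s has_real_derivative exx s x) (at x within {a..b})"
    and et_cont: "continuous_on ({0..T} \<times> {a..b}) (\<lambda>(s, x). et s x)"
    and exx_cont: "continuous_on ({0..T} \<times> {a..b}) (\<lambda>(s, x). exx s x)"
    and e_left: "\<And>s. s \<in> {0..T} \<Longrightarrow> e s a = 0"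
    and e_right: "\<And>s. s \<in> {0..T} \<Longrightarrow> e s b = 0"
begin

lemma e_section: "s \<in> {0..T} \<Longrightarrow> continuous_on {a..b} (e s)"
  using e_x by (rule DERIV_continuous_on)

lemma ex_section: "s \<in> {0..T} \<Longrightarrow> continuous_on {a..b} (ex s)"
  using e_xx by (rule DERIV_continuous_on)

lemma exx_section: "s \<in> {0..T} \<Longrightarrow> continuous_on {a..b} (exx s)"
  using exx_cont by (rule continuous_on_section)

lemma et_section: "s \<in> {0..T} \<Longrightarrow> continuous_on {a..b} (et s)"
  using et_cont by (rule continuous_on_section)

text \<open>
The difference of two squares is the product of the space derivatives of \<open>e s - e t\<close> and
\<open>e s + e t\<close>, so integrating by parts moves a derivative off the first factor.
\<close>

lemma gradient_energy_increment:
  assumes s: "s \<in> {0..T}" and t: "t \<in> {0..T}"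
  shows "integral {a..b} (\<lambda>x. (ex s x)\<^sup>2) - integral {a..b} (\<lambda>x. (ex t x)\<^sup>2)
    = - integral {a..b} (\<lambda>x. (e s x - e t x) * (exx s x + exx t x))"
proof -
  note sections = e_section[OF s] e_section[OF t] ex_section[OF s] ex_section[OF t]
    exx_section[OF s] exx_section[OF t]
  have "integral {a..b} (\<lambda>x. (ex s x)\<^sup>2) - integral {a..b} (\<lambda>x. (ex t x)\<^sup>2)
      = integral {a..b} (\<lambda>x. (ex s x)\<^sup>2 - (ex t x)\<^sup>2)"
    by (rule integral_diff[symmetric])
      (auto intro!: integrable_continuous_real continuous_intros sections)
  also have "\<dots> = integral {a..b} (\<lambda>x. (ex s x - ex t x) * (ex s x + ex t x))"
    by (simp add: power2_eq_square algebra_simps)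
  also have "\<dots> = - integral {a..b} (\<lambda>x. (e s x - e t x) * (exx s x + exx t x))"
    by (rule integral_by_parts_zero_boundary)
      (use ab e_left e_right e_x e_xx s t in
        \<open>auto intro!: DERIV_diff DERIV_add continuous_intros sections\<close>)
  finally show ?thesis .
qed

text \<open>
In the increment the factor \<open>exx s + exx t\<close> is split as \<open>2 exx t + (exx s - exx t)\<close>. The first
part \<open>P\<close> depends on time only through \<open>e s\<close> and is differentiated under the integral; the second
part \<open>R\<close> is a product of a factor Lipschitz in time with one tending to zero.
\<close>

lemma gradient_energy_derivative:
  assumes t: "t \<in> {0..T}"
  shows "((\<lambda>s. integral {a..b} (\<lambda>x. (ex s x)\<^sup>2)) has_real_derivative
    - 2 * integral {a..b} (\<lambda>x. et t x * exx t x)) (at t within {0..T})"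
proof -
  define P where "P s = integral {a..b} (\<lambda>x. (e s x - e t x) * exx t x)" for s
  define R where "R s = integral {a..b} (\<lambda>x. (e s x - e t x) * (exx s x - exx t x))" for s
  define w where "w s = integral {a..b} (\<lambda>x. \<bar>exx s x - exx t x\<bar>)" for s
  note sections = e_section e_section[OF t] exx_section exx_section[OF t]
  have exx_t: "continuous_on ({0..T} \<times> {a..b}) (\<lambda>p. exx t (snd p))"
    by (rule continuous_on_compose2[OF exx_section[OF t]]) (auto intro!: continuous_intros)
  have P': "(P has_real_derivative integral {a..b} (\<lambda>x. et t x * exx t x)) (at t within {0..T})"
    unfolding P_def[abs_def] cbox_interval[of a b, symmetric]
  proof (rule leibniz_rule_field_derivative[where fx = "\<lambda>s x. et s x * exx t x"])
    show "continuous_on ({0..T} \<times> cbox a b) (\<lambda>(s, x). et s x * exx t x)"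
      using et_cont exx_t by (auto simp: split_beta intro!: continuous_intros)
  qed (use t e_t sections in \<open>auto simp: cbox_interval intro!: derivative_eq_intros
        integrable_continuous_real continuous_intros\<close>)
  obtain K where K: "\<And>s x. s \<in> {0..T} \<Longrightarrow> x \<in> {a..b} \<Longrightarrow> \<bar>et s x\<bar> \<le> K"
  proof -
    have "compact ((\<lambda>(s, x). et s x) ` ({0..T} \<times> {a..b}))"
      by (intro compact_continuous_image et_cont compact_Times compact_Icc)
    then have "bounded ((\<lambda>(s, x). et s x) ` ({0..T} \<times> {a..b}))" by (rule compact_imp_bounded)
    then show ?thesis using that unfolding bounded_iff by force
  qed
  have e_lip: "\<bar>e s x - e t x\<bar> \<le> K * \<bar>s - t\<bar>" if "s \<in> {0..T}" "x \<in> {a..b}" for s x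
    using field_differentiable_bound[of "{0..T}" "\<lambda>s. e s x" "\<lambda>s. et s x" K s t] e_t K that t
    by (auto simp: norm_minus_commute)
  have R_le: "\<bar>R s\<bar> \<le> K * \<bar>s - t\<bar> * w s" if s: "s \<in> {0..T}" for s
  proof -
    have "norm (R s) \<le> integral {a..b} (\<lambda>x. K * \<bar>s - t\<bar> * \<bar>exx s x - exx t x\<bar>)"
      unfolding R_def
    proof (rule integral_norm_bound_integral)
      fix x assume "x \<in> {a..b}"
      then show "norm ((e s x - e t x) * (exx s x - exx t x)) \<le> K * \<bar>s - t\<bar> * \<bar>exx s x - exx t x\<bar>"
        using e_lip[OF s] by (simp add: abs_mult mult_right_mono)
    qed (use s in \<open>auto intro!: integrable_continuous_real continuous_intros sections\<close>)
    then show ?thesis by (simp add: w_def)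
  qed
  have "continuous_on {0..T} w"
    unfolding w_def[abs_def] cbox_interval[of a b, symmetric]
    using exx_cont exx_t
    by (intro integral_continuous_on_param) (auto simp: split_beta cbox_interval intro!: continuous_intros)
  moreover have w_t: "w t = 0" by (simp add: w_def)
  ultimately have w_lim: "(w \<longlongrightarrow> 0) (at t within {0..T})"
    using t continuous_on_def[of "{0..T}" w] by (metis w_t)
  have "((\<lambda>s. (R s - R t) / (s - t)) \<longlongrightarrow> 0) (at t within {0..T})"
  proof (rule Lim_null_comparison)
    show "((\<lambda>s. K * w s) \<longlongrightarrow> 0) (at t within {0..T})"
      using tendsto_mult_left[OF w_lim, of K] by simp
    have "norm ((R s - R t) / (s - t)) \<le> K * w s" if "s \<in> {0..T}" "s \<noteq> t" for s
      using R_le[OF that(1)] that(2) by (simp add: R_def divide_le_eq mult_ac)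
    then show "\<forall>\<^sub>F s in at t within {0..T}. norm ((R s - R t) / (s - t)) \<le> K * w s"
      by (auto simp: eventually_at_filter)
  qed
  then have R': "(R has_real_derivative 0) (at t within {0..T})"
    by (simp add: has_field_derivative_iff)
  have Q_eq: "integral {a..b} (\<lambda>x. (ex t x)\<^sup>2) - 2 * P s - R s = integral {a..b} (\<lambda>x. (ex s x)\<^sup>2)"
    if s: "s \<in> {0..T}" for s
  proof -
    have "integral {a..b} (\<lambda>x. (e s x - e t x) * (exx s x + exx t x))
        = integral {a..b} (\<lambda>x. 2 * ((e s x - e t x) * exx t x) + (e s x - e t x) * (exx s x - exx t x))"
      by (simp add: algebra_simps)
    also have "\<dots> = 2 * P s + R s"
      unfolding P_def R_def
      by (subst integral_add) (auto intro!: integrable_continuous_real continuous_intros sections s)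
    finally show ?thesis using gradient_energy_increment[OF s t] by simp
  qed
  have "((\<lambda>s. integral {a..b} (\<lambda>x. (ex t x)\<^sup>2) - 2 * P s - R s) has_real_derivative
      - 2 * integral {a..b} (\<lambda>x. et t x * exx t x)) (at t within {0..T})"
    by (auto intro!: derivative_eq_intros P' R')
  then show ?thesis
    by (rule has_field_derivative_transform_within[where d = 1]) (use t Q_eq in auto)
qed

text \<open>
Young's inequality is weighted so that the kinetic term it produces is exactly the one in the
energy. Gronwall's inequality then applies with rate one, so apart from \<open>\<kappa>\<close> the bound depends on
\<open>\<rho>\<close>, the interval and the time only.
\<close>

lemma energy_estimate:
  fixes ett :: "real \<Rightarrow> real \<Rightarrow> real"
  assumes \<rho>: "0 < \<rho>"
    and et_t: "\<And>s x. s \<in> {0..T} \<Longrightarrow> x \<in> {a..b} \<Longrightarrow>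
      ((\<lambda>s. et s x) has_real_derivative ett s x) (at s within {0..T})"
    and ett_cont: "continuous_on ({0..T} \<times> {a..b}) (\<lambda>(s, x). ett s x)"
    and residual: "\<And>s x. s \<in> {0..T} \<Longrightarrow> x \<in> {a..b} \<Longrightarrow> \<bar>\<rho> * ett s x - E * exx s x\<bar> \<le> \<kappa>"
    and e_0: "\<And>x. x \<in> {a..b} \<Longrightarrow> e 0 x = 0" and et_0: "\<And>x. x \<in> {a..b} \<Longrightarrow> et 0 x = 0"
    and E: "0 \<le> E" and t: "t \<in> {0..T}"
  shows "\<rho> * integral {a..b} (\<lambda>x. (et t x)\<^sup>2) + E * integral {a..b} (\<lambda>x. (ex t x)\<^sup>2)
    \<le> \<kappa>\<^sup>2 * (b - a) / \<rho> * (exp t - 1)"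
proof -
  define N where "N s = \<rho> * integral {a..b} (\<lambda>x. (et s x)\<^sup>2) + E * integral {a..b} (\<lambda>x. (ex s x)\<^sup>2)" for s
  define N' where "N' s = \<rho> * integral {a..b} (\<lambda>x. 2 * et s x * ett s x)
      + E * (- 2 * integral {a..b} (\<lambda>x. et s x * exx s x))" for s
  have ett_section: "continuous_on {a..b} (ett s)" if "s \<in> {0..T}" for s
    using ett_cont that by (rule continuous_on_section)
  note sections = et_section exx_section ex_section ett_section
  have kin: "((\<lambda>s. integral {a..b} (\<lambda>x. (et s x)\<^sup>2)) has_real_derivative
      integral {a..b} (\<lambda>x. 2 * et s x * ett s x)) (at s within {0..T})" if "s \<in> {0..T}" for s
    unfolding cbox_interval[of a b, symmetric]
  proof (rule leibniz_rule_field_derivative[where fx = "\<lambda>s x. 2 * et s x * ett s x"])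
    show "continuous_on ({0..T} \<times> cbox a b) (\<lambda>(s, x). 2 * et s x * ett s x)"
      using et_cont ett_cont by (auto simp: split_beta intro!: continuous_intros)
  qed (use that et_t sections in \<open>auto simp: cbox_interval intro!: derivative_eq_intros
        integrable_continuous_real continuous_intros\<close>)
  have N_deriv: "(N has_real_derivative N' s) (at s within {0..T})" if "s \<in> {0..T}" for s
    unfolding N_def[abs_def] N'_def
    by (intro DERIV_add DERIV_cmult kin gradient_energy_derivative that)
  have N'_le: "N' s \<le> N s + \<kappa>\<^sup>2 * (b - a) / \<rho>" if s: "s \<in> {0..T}" for s
  proof -
    have "N' s = integral {a..b} (\<lambda>x. \<rho> * (2 * et s x * ett s x) - 2 * E * (et s x * exx s x))"
      unfolding N'_def
      by (subst integral_diff) (auto intro!: integrable_continuous_real continuous_intros sections s)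
    also have "\<dots> \<le> integral {a..b} (\<lambda>x. \<rho> * (et s x)\<^sup>2 + \<kappa>\<^sup>2 / \<rho>)"
    proof (rule integral_le)
      fix x assume x: "x \<in> {a..b}"
      define r where "r = \<rho> * ett s x - E * exx s x"
      have "\<bar>r\<bar> \<le> \<kappa>" using residual[OF s x] by (simp add: r_def)
      then have "r\<^sup>2 \<le> \<kappa>\<^sup>2" using power_mono[of "\<bar>r\<bar>" \<kappa> 2] by simp
      then have "r\<^sup>2 / \<rho> \<le> \<kappa>\<^sup>2 / \<rho>" using \<rho> by (simp add: divide_right_mono)
      moreover have "0 \<le> (\<rho> * et s x - r)\<^sup>2 / \<rho>" using \<rho> by simp
      moreover have "(\<rho> * et s x - r)\<^sup>2 / \<rho> = \<rho> * (et s x)\<^sup>2 - 2 * et s x * r + r\<^sup>2 / \<rho>"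
        using \<rho> by (simp add: power2_eq_square field_simps)
      ultimately have "2 * et s x * r \<le> \<rho> * (et s x)\<^sup>2 + \<kappa>\<^sup>2 / \<rho>" by linarith
      then show "\<rho> * (2 * et s x * ett s x) - 2 * E * (et s x * exx s x)
          \<le> \<rho> * (et s x)\<^sup>2 + \<kappa>\<^sup>2 / \<rho>"
        by (simp add: r_def algebra_simps)
    qed (auto intro!: integrable_continuous_real continuous_intros sections s)
    also have "\<dots> = \<rho> * integral {a..b} (\<lambda>x. (et s x)\<^sup>2) + \<kappa>\<^sup>2 * (b - a) / \<rho>"
      using ab by (subst integral_add)
        (auto intro!: integrable_continuous_real continuous_intros sections s)
    also have "\<dots> \<le> N s + \<kappa>\<^sup>2 * (b - a) / \<rho>"
      using E by (auto simp: N_def intro!: mult_nonneg_nonneg integral_nonneg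
          integrable_continuous_real continuous_intros sections s)
    finally show ?thesis .
  qed
  have "N 0 = 0"
  proof -
    have 0: "0 \<in> {0..T}" using t by auto
    have "ex 0 x = 0" if "x \<in> {a..b}" for x
    proof -
      have "((\<lambda>_. 0) has_real_derivative ex 0 x) (at x within {a..b})"
        by (rule has_field_derivative_transform_within[OF e_x[OF 0 that], where d = 1]) (use e_0 that in auto)
      moreover have "((\<lambda>_. 0) has_real_derivative 0) (at x within {a..b})" by simp
      ultimately show ?thesis using deriv_on_Icc_eqI[OF ab that] by metis
    qed
    then have "integral {a..b} (\<lambda>x. (ex 0 x)\<^sup>2) = integral {a..b} (\<lambda>x. 0)"
      and "integral {a..b} (\<lambda>x. (et 0 x)\<^sup>2) = integral {a..b} (\<lambda>x. 0)"
      by (intro integral_cong; use et_0 in simp)+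
    then show ?thesis by (simp add: N_def)
  qed
  from Gronwall_unit_rate[where \<phi> = N, OF N_deriv N'_le this t] show ?thesis
    by (simp add: N_def)
qed

end

section \<open>The error for a single horizon\<close>

lemma zero_ext_smooth_profile:
  assumes ab: "a < b" and eps: "0 < \<epsilon>" and Ck: "Ck_on 4 {a..b} w"
    and zero: "\<And>x. x \<in> nonlocal_boundary a b \<epsilon> \<Longrightarrow> w x = 0"
    and top: "\<And>x. x \<in> {a..b} \<Longrightarrow> \<bar>nderiv_on 4 {a..b} w x\<bar> \<le> B"
  shows "smooth_profile (zero_ext a b w) (zero_ext a b (nderiv_on 1 {a..b} w))
    (zero_ext a b (nderiv_on 2 {a..b} w)) (B * ((b - a) + (b - a)\<^sup>2 + (b - a) ^ 3))"
    (is "smooth_profile ?v ?v1 ?v2 ?V")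
proof
  let ?v3 = "zero_ext a b (nderiv_on 3 {a..b} w)"
  note der = zero_ext_nderiv_on[OF ab eps Ck _ zero]
  note bound = zero_ext_nderiv_on_bound[OF ab eps Ck zero top]
  have B: "0 \<le> B" using top[of a] ab by force
  have "0 \<le> b - a" "0 \<le> (b - a)\<^sup>2" "0 \<le> (b - a) ^ 3" using ab by auto
  then have le: "B * (b - a) \<le> ?V" "B * (b - a)\<^sup>2 \<le> ?V" "B * (b - a) ^ 3 \<le> ?V"
    by (intro mult_left_mono[OF _ B]; linarith)+
  show "(?v has_real_derivative ?v1 z) (at z)" for z
    using der[of 0 z] by simp
  show "(?v1 has_real_derivative ?v2 z) (at z)" for z
    using der[of 1 z] by (simp add: numeral_2_eq_2)
  have v2: "(?v2 has_real_derivative ?v3 z) (at z)" for z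
    using der[of 2 z] by (simp add: eval_nat_numeral)
  show "\<bar>?v1 z\<bar> \<le> ?V" for z
    using bound[of 1 z] le by simp
  show "\<bar>?v2 z\<bar> \<le> ?V" for z
    using bound[of 2 z] le by simp
  have v3: "\<bar>?v3 z\<bar> \<le> ?V" for z
    using bound[of 3 z] le by simp
  show "\<bar>?v2 y - ?v2 z\<bar> \<le> ?V * \<bar>y - z\<bar>" for y z
    using field_differentiable_bound[of UNIV ?v2 ?v3 ?V y z] v2 v3 by simp
qed

lemma LINT_eq_integral:
  fixes g p :: "real \<Rightarrow> real"
  assumes "continuous_on {a..b} p" and "\<And>x. x \<in> {a..b} \<Longrightarrow> g x = p x"
  shows "(LINT x:{a..b}|lebesgue. g x) = integral {a..b} p"
proof -
  have "(LINT x:{a..b}|lebesgue. g x) = (LINT x:{a..b}|lebesgue. p x)"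
    by (rule set_lebesgue_integral_cong) (use assms(2) in auto)
  also have "\<dots> = integral {a..b} p"
    by (intro set_lebesgue_integral_eq_integral absolutely_integrable_continuous_real assms(1))
  finally show ?thesis .
qed

text \<open>
The wave equation for the difference is obtained by replacing the peridynamic displacement by its
zero extension inside the force: at points of the interval the force sees the displacement only on
the interval and on the nonlocal boundary, where the two agree.
\<close>

lemma error_estimate:
  fixes u w :: "real \<Rightarrow> real \<Rightarrow> real"
  defines "e \<equiv> \<lambda>t x. w t x - u t x"
  assumes ab: "a < b" and T: "0 < T" and \<rho>: "0 < \<rho>" and E: "0 \<le> E" and eps: "0 < \<epsilon>"
    and u: "elastodynamic_solution a b T \<rho> E bf g h u"
    and w: "peridynamic_solution a b T \<rho> f J bf g h \<epsilon> w"
    and Ck: "\<forall>t\<in>{0..T}. Ck_on 4 {a..b} (w t)"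
    and top: "\<forall>t\<in>{0..T}. \<forall>x\<in>{a..b}. \<bar>nderiv_on 4 {a..b} (w t) x\<bar> \<le> B"
    and consistency: "\<forall>v v1 v2 x. smooth_profile v v1 v2 (B * ((b - a) + (b - a)\<^sup>2 + (b - a) ^ 3)) \<longrightarrow>
      \<bar>pd_force f J \<epsilon> v x - E * v2 x\<bar> \<le> \<kappa>"
    and t: "t \<in> {0..T}"
  shows "(LINT x:{a..b}|lebesgue. \<rho> * \<bar>time_deriv T 1 e t x\<bar>\<^sup>2) +
      (LINT x:{a..b}|lebesgue. E * \<bar>deriv_on {a..b} (e t) x\<bar>\<^sup>2) \<le> \<kappa>\<^sup>2 * (b - a) / \<rho> * (exp t - 1)"
    and "(LINT x:{a..b}|lebesgue. \<bar>e t x\<bar>\<^sup>2)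
      \<le> 4 * (b - a)\<^sup>2 * (LINT x:{a..b}|lebesgue. \<bar>deriv_on {a..b} (e t) x\<bar>\<^sup>2)"
    and "(LINT x:{a..b}|lebesgue. E * \<bar>deriv_on {a..b} (e t) x\<bar>\<^sup>2)
      = E * (LINT x:{a..b}|lebesgue. \<bar>deriv_on {a..b} (e t) x\<bar>\<^sup>2)"
    and "0 \<le> (LINT x:{a..b}|lebesgue. \<rho> * \<bar>time_deriv T 1 e t x\<bar>\<^sup>2)"
proof -
  define et where "et s x = time_deriv T 1 w s x - time_deriv T 1 u s x" for s x
  define ett where "ett s x = time_deriv T 2 w s x - time_deriv T 2 u s x" for s x
  define ex where "ex s x = nderiv_on 1 {a..b} (w s) x - nderiv_on 1 {a..b} (u s) x" for s x
  define exx where "exx s x = nderiv_on 2 {a..b} (w s) x - nderiv_on 2 {a..b} (u s) x" for s x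
  have time: "((\<lambda>s. y s x) has_real_derivative time_deriv T 1 y s x) (at s within {0..T})"
      "((\<lambda>s. time_deriv T 1 y s x) has_real_derivative time_deriv T 2 y s x) (at s within {0..T})"
    if y: "C2_in_time a b T y" and "s \<in> {0..T}" "x \<in> {a..b}" for y s x
  proof -
    have "Ck_on 2 {0..T} (\<lambda>s. y s x)" using y that(3) by (auto simp: C2_in_time_def)
    note der = Ck_on_has_derivative[OF this _ that(2)]
    show "((\<lambda>s. y s x) has_real_derivative time_deriv T 1 y s x) (at s within {0..T})"
      using der[of 0] by (simp add: time_deriv_def)
    show "((\<lambda>s. time_deriv T 1 y s x) has_real_derivative time_deriv T 2 y s x) (at s within {0..T})"
      using der[of 1] by (simp add: time_deriv_def numeral_2_eq_2)
  qed
  have time_cont: "continuous_on ({0..T} \<times> {a..b}) (\<lambda>(s, x). time_deriv T k y s x)"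
    if "C2_in_time a b T y" "k \<le> 2" for y k
    using that by (auto simp: C2_in_time_def)
  have space: "(y has_real_derivative nderiv_on 1 {a..b} y x) (at x within {a..b})"
      "(nderiv_on 1 {a..b} y has_real_derivative nderiv_on 2 {a..b} y x) (at x within {a..b})"
    if y: "Ck_on k {a..b} y" and "2 \<le> k" "x \<in> {a..b}" for y k x
    using Ck_on_has_derivative[OF y, of 0 x] Ck_on_has_derivative[OF y, of 1 x] that
    by (simp_all add: numeral_2_eq_2)
  have uT: "C2_in_time a b T u" and uX: "C2_in_space a b T u"
    and wT: "C2_in_time a b T w"
    using u w by (auto simp: elastodynamic_solution_def peridynamic_solution_def)
  have uCk: "Ck_on 2 {a..b} (u s)" if "s \<in> {0..T}" for s
    using uX that by (auto simp: C2_in_space_def)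
  have zero: "w s x = 0" if "s \<in> {0..T}" "x \<in> nonlocal_boundary a b \<epsilon>" for s x
    using w that by (auto simp: peridynamic_solution_def)
  have ends: "a \<in> nonlocal_boundary a b \<epsilon>" "b \<in> nonlocal_boundary a b \<epsilon>"
    using eps by (auto simp: nonlocal_boundary_def)
  let ?v = "\<lambda>s. zero_ext a b (w s)" and ?v1 = "\<lambda>s. zero_ext a b (nderiv_on 1 {a..b} (w s))"
    and ?v2 = "\<lambda>s. zero_ext a b (nderiv_on 2 {a..b} (w s))"
  have profile: "smooth_profile (?v s) (?v1 s) (?v2 s) (B * ((b - a) + (b - a)\<^sup>2 + (b - a) ^ 3))"
    if "s \<in> {0..T}" for s
    by (rule zero_ext_smooth_profile[OF ab eps Ck[rule_format, OF that] zero[OF that]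
          top[rule_format, OF that]])
  (* The zero extension is the composition with the projection onto the interval, because the
     displacement vanishes at both end points. *)
  have v_cont: "continuous_on ({0..T} \<times> UNIV) (\<lambda>(s, x). ?v s x)"
  proof -
    have "continuous_on ({0..T} \<times> UNIV) (\<lambda>p. (\<lambda>(s, x). time_deriv T 0 w s x) (fst p, max a (min b (snd p))))"
      by (rule continuous_on_compose2[OF time_cont[OF wT]]) (use ab in \<open>auto intro!: continuous_intros\<close>)
    moreover have "(\<lambda>(s, x). time_deriv T 0 w s x) (fst p, max a (min b (snd p))) = (\<lambda>(s, x). ?v s x) p"
      if "p \<in> {0..T} \<times> UNIV" for p
      using that zero[OF _ ends(1)] zero[OF _ ends(2)] ab
      by (auto simp: time_deriv_def zero_ext_def max_def min_def split_beta)
    ultimately show ?thesis by (rule continuous_on_eq)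
  qed
  have v2_cont: "continuous_on ({0..T} \<times> UNIV) (\<lambda>(s, x). ?v2 s x)"
    by (rule second_derivative_jointly_continuous[OF profile v_cont])
  have v2_eq: "?v2 s x = nderiv_on 2 {a..b} (w s) x" if "x \<in> {a..b}" for s x
    unfolding zero_ext_def using that by meson
  have w2_cont: "continuous_on ({0..T} \<times> {a..b}) (\<lambda>(s, x). nderiv_on 2 {a..b} (w s) x)"
  proof (rule continuous_on_eq)
    show "continuous_on ({0..T} \<times> {a..b}) (\<lambda>(s, x). ?v2 s x)"
      using v2_cont by (rule continuous_on_subset) auto
    show "(\<lambda>(s, x). ?v2 s x) p = (\<lambda>(s, x). nderiv_on 2 {a..b} (w s) x) p" if "p \<in> {0..T} \<times> {a..b}" for p
      unfolding split_beta using that by (intro v2_eq) auto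
  qed
  have u2_cont: "continuous_on ({0..T} \<times> {a..b}) (\<lambda>(s, x). nderiv_on 2 {a..b} (u s) x)"
    using uX unfolding C2_in_space_def by blast
  interpret wave_regular a b T e et ex exx
  proof
    fix s x assume s: "s \<in> {0..T}" and x: "x \<in> {a..b}"
    show "((\<lambda>s. e s x) has_real_derivative et s x) (at s within {0..T})"
      unfolding e_def et_def by (intro DERIV_diff time(1) uT wT s x)
    show "(e s has_real_derivative ex s x) (at x within {a..b})"
      unfolding e_def ex_def by (intro DERIV_diff space(1)[OF uCk[OF s]] space(1)[OF Ck[rule_format, OF s]] x) auto
    show "(ex s has_real_derivative exx s x) (at x within {a..b})"
      unfolding ex_def[abs_def] exx_def by (intro DERIV_diff space(2)[OF uCk[OF s]] space(2)[OF Ck[rule_format, OF s]] x) auto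
  next
    show "continuous_on ({0..T} \<times> {a..b}) (\<lambda>(s, x). et s x)"
      using time_cont[OF uT, of 1] time_cont[OF wT, of 1]
      by (auto simp: et_def split_beta intro!: continuous_on_diff)
    show "continuous_on ({0..T} \<times> {a..b}) (\<lambda>(s, x). exx s x)"
      unfolding exx_def split_beta
      using w2_cont u2_cont unfolding split_beta by (rule continuous_on_diff)
  next
    fix s assume s: "s \<in> {0..T}"
    show "e s a = 0" "e s b = 0"
      using zero[OF s] ends u s by (auto simp: e_def elastodynamic_solution_def)
  qed (rule ab)
  have "\<rho> * integral {a..b} (\<lambda>x. (et t x)\<^sup>2) + E * integral {a..b} (\<lambda>x. (ex t x)\<^sup>2)
    \<le> \<kappa>\<^sup>2 * (b - a) / \<rho> * (exp t - 1)"
  proof (rule energy_estimate[OF \<rho> _ _ _ _ _ E t, where ett = ett])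
    fix s x assume s: "s \<in> {0..T}" and x: "x \<in> {a..b}"
    show "((\<lambda>s. et s x) has_real_derivative ett s x) (at s within {0..T})"
      unfolding et_def ett_def by (intro DERIV_diff time(2) uT wT s x)
    have "pd_force f J \<epsilon> (w s) x = pd_force f J \<epsilon> (?v s) x"
    proof (rule pd_force_cong_open[OF eps])
      fix y assume "\<bar>y - x\<bar> < \<epsilon>"
      then have "y \<in> {a..b} \<or> y \<in> nonlocal_boundary a b \<epsilon>"
        using x by (auto simp: nonlocal_boundary_def)
      then show "w s y = ?v s y" using zero[OF s] by (auto simp: zero_ext_def)
    qed
    then have "\<bar>pd_force f J \<epsilon> (w s) x - E * nderiv_on 2 {a..b} (w s) x\<bar> \<le> \<kappa>"
      using consistency[rule_format, OF profile[OF s], of x] v2_eq[OF x, of s] by metis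
    moreover have "\<rho> * time_deriv T 2 w s x = pd_force f J \<epsilon> (w s) x + bf s x"
      using w s x unfolding peridynamic_solution_def by blast
    moreover have "\<rho> * time_deriv T 2 u s x = E * nderiv_on 2 {a..b} (u s) x + bf s x"
      using u s x unfolding elastodynamic_solution_def by blast
    ultimately show "\<bar>\<rho> * ett s x - E * exx s x\<bar> \<le> \<kappa>"
      unfolding ett_def exx_def right_diff_distrib by linarith
  next
    show "continuous_on ({0..T} \<times> {a..b}) (\<lambda>(s, x). ett s x)"
      using time_cont[OF uT, of 2] time_cont[OF wT, of 2]
      by (auto simp: ett_def split_beta intro!: continuous_on_diff)
    fix x assume "x \<in> {a..b}"
    then show "e 0 x = 0" "et 0 x = 0"
      using u w by (auto simp: e_def et_def elastodynamic_solution_def peridynamic_solution_def initial_cond_def)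
  qed
  moreover have te: "time_deriv T 1 e t x = et t x" if "x \<in> {a..b}" for x
    using deriv_on_Icc_eqI[OF T t e_t[OF t that]] by (simp add: time_deriv_def)
  moreover have xe: "deriv_on {a..b} (e t) x = ex t x" if "x \<in> {a..b}" for x
    by (rule deriv_on_Icc_eqI[OF ab that e_x[OF t that]])
  have L1: "(LINT x:{a..b}|lebesgue. \<rho> * \<bar>time_deriv T 1 e t x\<bar>\<^sup>2) = \<rho> * integral {a..b} (\<lambda>x. (et t x)\<^sup>2)"
    by (subst LINT_eq_integral[where p = "\<lambda>x. \<rho> * (et t x)\<^sup>2"])
      (auto simp: te simp del: One_nat_def intro!: continuous_intros et_section t)
  have L2: "(LINT x:{a..b}|lebesgue. c * \<bar>deriv_on {a..b} (e t) x\<bar>\<^sup>2) = c * integral {a..b} (\<lambda>x. (ex t x)\<^sup>2)" for c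
    by (subst LINT_eq_integral[where p = "\<lambda>x. c * (ex t x)\<^sup>2"])
      (auto simp: xe intro!: continuous_intros ex_section t)
  have L3: "(LINT x:{a..b}|lebesgue. \<bar>e t x\<bar>\<^sup>2) = integral {a..b} (\<lambda>x. (e t x)\<^sup>2)"
    by (subst LINT_eq_integral[where p = "\<lambda>x. (e t x)\<^sup>2"])
      (auto intro!: continuous_intros e_section t)
  ultimately show "(LINT x:{a..b}|lebesgue. \<rho> * \<bar>time_deriv T 1 e t x\<bar>\<^sup>2) +
      (LINT x:{a..b}|lebesgue. E * \<bar>deriv_on {a..b} (e t) x\<bar>\<^sup>2) \<le> \<kappa>\<^sup>2 * (b - a) / \<rho> * (exp t - 1)"
    by (simp only: L1 L2)
  show "(LINT x:{a..b}|lebesgue. \<bar>e t x\<bar>\<^sup>2)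
      \<le> 4 * (b - a)\<^sup>2 * (LINT x:{a..b}|lebesgue. \<bar>deriv_on {a..b} (e t) x\<bar>\<^sup>2)"
    unfolding L3 using Poincare_inequality[OF less_imp_le[OF ab] e_x[OF t] ex_section[OF t] e_right[OF t]] L2[of 1]
    by simp
  show "(LINT x:{a..b}|lebesgue. E * \<bar>deriv_on {a..b} (e t) x\<bar>\<^sup>2)
      = E * (LINT x:{a..b}|lebesgue. \<bar>deriv_on {a..b} (e t) x\<bar>\<^sup>2)"
    using L2[of E] L2[of 1] by simp
  show "0 \<le> (LINT x:{a..b}|lebesgue. \<rho> * \<bar>time_deriv T 1 e t x\<bar>\<^sup>2)"
    unfolding L1 using \<rho> by (auto intro!: mult_nonneg_nonneg integral_nonneg
        integrable_continuous_real continuous_intros et_section t)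
qed

section \<open>Convergence in the horizon\<close>

theorem theorem1:
  fixes a b T \<rho> M C1 :: real
    and f J :: "real \<Rightarrow> real"
    and bf :: "real \<Rightarrow> real \<Rightarrow> real"
  assumes "a < b" and "0 < T" and "0 < \<rho>"
    and "admissible_potential f"
    and "admissible_influence M J"
    and "0 < youngs_modulus f J"
    and "0 < C1"
  shows "\<exists>C2>0. \<exists>C>0. \<forall>\<delta> D' g h u u\<epsilon>.
    0 < \<delta> \<longrightarrow> D' \<subseteq> {a + \<delta>..b - \<delta>} \<longrightarrow>
    (\<forall>x. x \<notin> D' \<longrightarrow> g x = 0 \<and> h x = 0) \<longrightarrow>
    elastodynamic_solution a b T \<rho> (youngs_modulus f J) bf g h u \<longrightarrow>
    (\<forall>\<epsilon>\<in>{0<..<\<delta>}. peridynamic_solution a b T \<rho> f J bf g h \<epsilon> (u\<epsilon> \<epsilon>)) \<longrightarrow>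
    (\<forall>\<epsilon>\<in>{0<..<\<delta>}. \<forall>t\<in>{0..T}. Ck_on 4 {a..b} (u\<epsilon> \<epsilon> t)) \<longrightarrow>
    (SUP \<epsilon>\<in>{0<..<\<delta>}. SUP (x, t)\<in>{a..b} \<times> {0..T}.
        ereal \<bar>nderiv_on 4 {a..b} (u\<epsilon> \<epsilon> t) x\<bar>) < ereal C1 \<longrightarrow>
    (\<forall>\<epsilon>\<in>{0<..<\<delta>}.
      let e = (\<lambda>t x. u\<epsilon> \<epsilon> t x - u t x) in
        (SUP t\<in>{0..T}. ereal (
            (LINT x:{a..b}|lebesgue. \<rho> * \<bar>time_deriv T 1 e t x\<bar>\<^sup>2) +
            (LINT x:{a..b}|lebesgue. youngs_modulus f J * \<bar>deriv_on {a..b} (e t) x\<bar>\<^sup>2)))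
          \<le> ereal (C2 * \<epsilon>\<^sup>2) \<and>
        (SUP t\<in>{0..T}. ereal (H1_norm a b (\<lambda>x. u\<epsilon> \<epsilon> t x - u t x))) \<le> ereal (C * \<epsilon>))"
proof -
  let ?d0 = "deriv_on {0..} f 0" and ?A = "nderiv_on 2 {0..} f 0" and ?E = "youngs_modulus f J"
  obtain B where cont: "continuous_on {0..} (deriv_on {0..} f)" and B: "0 \<le> B"
    and expansion: "\<And>r. 0 \<le> r \<Longrightarrow> \<bar>deriv_on {0..} f r - ?d0 - ?A * r\<bar> \<le> B * r\<^sup>2"
    using potential_deriv_expansion[OF assms(4)] by blast
  define V where "V = C1 * ((b - a) + (b - a)\<^sup>2 + (b - a) ^ 3)"
  define K where "K = 4 * M * (\<bar>?d0\<bar> * V + 3 * \<bar>?A\<bar> * V ^ 3 + B * V ^ 5)"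
  define C2 where "C2 = K\<^sup>2 * (b - a) / \<rho> * exp T + 1"
  (* The energy controls E times the squared gradient, and the Poincare inequality adds the factor
     in parentheses; the summand 1 in C2 makes both constants positive. *)
  define C where "C = sqrt ((4 * (b - a)\<^sup>2 + 1) * C2 / ?E)"
  have "0 < C2"
    using assms(1-3) by (auto simp: C2_def intro!: add_nonneg_pos mult_nonneg_nonneg divide_nonneg_nonneg)
  then have "0 < C"
    using assms(6) by (auto simp: C_def intro!: divide_pos_pos mult_pos_pos add_nonneg_pos)
  have bounds: "(LINT x:{a..b}|lebesgue. \<rho> * \<bar>time_deriv T 1 (\<lambda>t x. w t x - u t x) t x\<bar>\<^sup>2) +
        (LINT x:{a..b}|lebesgue. ?E * \<bar>deriv_on {a..b} (\<lambda>x. w t x - u t x) x\<bar>\<^sup>2) \<le> C2 * \<epsilon>\<^sup>2"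
      "H1_norm a b (\<lambda>x. w t x - u t x) \<le> C * \<epsilon>"
    if u: "elastodynamic_solution a b T \<rho> ?E bf g h u" and eps: "0 < \<epsilon>"
      and w: "peridynamic_solution a b T \<rho> f J bf g h \<epsilon> w"
      and Ck: "\<forall>t\<in>{0..T}. Ck_on 4 {a..b} (w t)"
      and top: "\<forall>t\<in>{0..T}. \<forall>x\<in>{a..b}. \<bar>nderiv_on 4 {a..b} (w t) x\<bar> \<le> C1"
      and t: "t \<in> {0..T}" for g h u \<epsilon> w t
  proof -
    have consistency: "\<forall>v v1 v2 x. smooth_profile v v1 v2 V \<longrightarrow> \<bar>pd_force f J \<epsilon> v x - ?E * v2 x\<bar> \<le> K * \<epsilon>"
      using smooth_profile.pd_force_consistency[OF _ eps assms(5) cont B expansion]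
      unfolding K_def by blast
    note est = error_estimate[OF assms(1-3) less_imp_le[OF assms(6)] eps u w Ck top
      consistency[unfolded V_def] t]
    let ?e = "\<lambda>x. w t x - u t x"
    let ?I = "LINT x:{a..b}|lebesgue. \<bar>deriv_on {a..b} ?e x\<bar>\<^sup>2"
    have "(K * \<epsilon>)\<^sup>2 * (b - a) / \<rho> * (exp t - 1) = (K\<^sup>2 * (b - a) / \<rho> * (exp t - 1)) * \<epsilon>\<^sup>2"
      by (simp add: power_mult_distrib)
    also have "\<dots> \<le> C2 * \<epsilon>\<^sup>2"
    proof (rule mult_right_mono)
      have "K\<^sup>2 * (b - a) / \<rho> * (exp t - 1) \<le> K\<^sup>2 * (b - a) / \<rho> * exp T"
        using assms(1,3) t by (intro mult_left_mono) (auto intro: order_trans[of _ "exp t"])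
      then show "K\<^sup>2 * (b - a) / \<rho> * (exp t - 1) \<le> C2" by (simp add: C2_def)
    qed simp
    finally show energy: "(LINT x:{a..b}|lebesgue. \<rho> * \<bar>time_deriv T 1 (\<lambda>t x. w t x - u t x) t x\<bar>\<^sup>2) +
        (LINT x:{a..b}|lebesgue. ?E * \<bar>deriv_on {a..b} ?e x\<bar>\<^sup>2) \<le> C2 * \<epsilon>\<^sup>2"
      using est(1) by linarith
    then have "?E * ?I \<le> C2 * \<epsilon>\<^sup>2" using est(3,4) by linarith
    then have "?I \<le> C2 * \<epsilon>\<^sup>2 / ?E" using assms(6) by (simp add: pos_le_divide_eq mult.commute)
    then have "(4 * (b - a)\<^sup>2 + 1) * ?I \<le> (4 * (b - a)\<^sup>2 + 1) * (C2 * \<epsilon>\<^sup>2 / ?E)"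
      by (rule mult_left_mono) simp
    also have "\<dots> = (4 * (b - a)\<^sup>2 + 1) * C2 / ?E * \<epsilon>\<^sup>2"
      by (simp only: times_divide_eq_right times_divide_eq_left mult.assoc)
    finally have "(LINT x:{a..b}|lebesgue. \<bar>?e x\<bar>\<^sup>2) + ?I \<le> (4 * (b - a)\<^sup>2 + 1) * C2 / ?E * \<epsilon>\<^sup>2"
      using est(2) unfolding distrib_right[of _ 1 ?I] by linarith
    then have "H1_norm a b ?e \<le> sqrt ((4 * (b - a)\<^sup>2 + 1) * C2 / ?E * \<epsilon>\<^sup>2)"
      unfolding H1_norm_def by (rule real_sqrt_le_mono)
    also have "\<dots> = C * \<epsilon>"
      using eps by (simp only: C_def real_sqrt_mult real_sqrt_abs abs_of_pos)
    finally show "H1_norm a b ?e \<le> C * \<epsilon>" .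
  qed
  show ?thesis
  proof (rule exI[of _ C2], rule conjI[OF \<open>0 < C2\<close>], rule exI[of _ C], rule conjI[OF \<open>0 < C\<close>],
      intro allI impI ballI)
    fix \<delta> :: real and D' :: "real set" and g h :: "real \<Rightarrow> real" and u :: "real \<Rightarrow> real \<Rightarrow> real"
      and u\<epsilon> :: "real \<Rightarrow> real \<Rightarrow> real \<Rightarrow> real" and \<epsilon> :: real
    assume u: "elastodynamic_solution a b T \<rho> ?E bf g h u"
      and w: "\<forall>\<epsilon>\<in>{0<..<\<delta>}. peridynamic_solution a b T \<rho> f J bf g h \<epsilon> (u\<epsilon> \<epsilon>)"
      and Ck: "\<forall>\<epsilon>\<in>{0<..<\<delta>}. \<forall>t\<in>{0..T}. Ck_on 4 {a..b} (u\<epsilon> \<epsilon> t)"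
      and sup: "(SUP \<epsilon>\<in>{0<..<\<delta>}. SUP (x, t)\<in>{a..b} \<times> {0..T}.
        ereal \<bar>nderiv_on 4 {a..b} (u\<epsilon> \<epsilon> t) x\<bar>) < ereal C1"
      and eps: "\<epsilon> \<in> {0<..<\<delta>}"
    have top: "\<forall>t\<in>{0..T}. \<forall>x\<in>{a..b}. \<bar>nderiv_on 4 {a..b} (u\<epsilon> \<epsilon> t) x\<bar> \<le> C1"
    proof (intro ballI)
      fix t x assume t: "t \<in> {0..T}" and x: "x \<in> {a..b}"
      have "ereal \<bar>nderiv_on 4 {a..b} (u\<epsilon> \<epsilon> t) x\<bar>
          \<le> (SUP (x, t)\<in>{a..b} \<times> {0..T}. ereal \<bar>nderiv_on 4 {a..b} (u\<epsilon> \<epsilon> t) x\<bar>)"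
        by (rule SUP_upper2[of "(x, t)"]) (use t x in auto)
      also have "\<dots> \<le> (SUP \<epsilon>\<in>{0<..<\<delta>}. SUP (x, t)\<in>{a..b} \<times> {0..T}.
          ereal \<bar>nderiv_on 4 {a..b} (u\<epsilon> \<epsilon> t) x\<bar>)"
        by (rule SUP_upper[OF eps])
      also note sup
      finally show "\<bar>nderiv_on 4 {a..b} (u\<epsilon> \<epsilon> t) x\<bar> \<le> C1" by simp
    qed
    have eps0: "0 < \<epsilon>" using eps by simp
    note b = bounds[OF u eps0 bspec[OF w eps] bspec[OF Ck eps] top]
    show "let e = (\<lambda>t x. u\<epsilon> \<epsilon> t x - u t x) in
        (SUP t\<in>{0..T}. ereal (
            (LINT x:{a..b}|lebesgue. \<rho> * \<bar>time_deriv T 1 e t x\<bar>\<^sup>2) +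
            (LINT x:{a..b}|lebesgue. ?E * \<bar>deriv_on {a..b} (e t) x\<bar>\<^sup>2)))
          \<le> ereal (C2 * \<epsilon>\<^sup>2) \<and>
        (SUP t\<in>{0..T}. ereal (H1_norm a b (\<lambda>x. u\<epsilon> \<epsilon> t x - u t x))) \<le> ereal (C * \<epsilon>)"
      unfolding Let_def ereal_less_eq by (intro conjI SUP_least) (simp_all only: ereal_less_eq(3) b)
  qed
qed

end
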